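(* Let $\mu\in\mathbb{C}$ with $\Re\mu>-1$, $\ell\in\mathbb{N}_0$, $j\in\mathbb{N}_0$. For $x>0$ the function $$x^{2\ell+1}\int_0^\pi\int_0^\infty e^{-x(\cosh\phi-1)}L_j^{\ell+\frac{\mu+1}{2}}\big(x(\cos\psi+\cosh\phi)\big)\sin^\mu\psi\,\sinh^{2\ell+1}\phi\,d\phi\,d\psi$$ is a polynomial in $x$ of degree $j+\ell$, and it equals $$\frac{2^\mu\,\ell!\,\Gamma(\frac{\mu+1}{2})\,\Gamma(j+\frac{\mu+1}{2})}{\Gamma(j+\mu+1)}M_j^{\mu,\ell}(2x).$$
   Context: $L_n^\alpha$ denotes the Laguerre polynomial $L_n^\alpha(x)=\sum_{k=0}^n\frac{(-1)^k}{k!}\binom{n+\alpha}{n-k}x^k$. Let $I_\alpha$, $K_\alpha$ be the modified Bessel functions and set $\widetilde I_\alpha(z)=(z/2)^{-\alpha}I_\alpha(z)$, $\widetilde K_\alpha(z)=(z/2)^{-\alpha}K_\alpha(z)$. For $\mu\in\mathbb{C}$, $\ell\in\mathbb{N}_0$, $x>0$ and $t$ near $0$ define $$G^{\mu,\ell}(t,x)=\frac{1}{(1-t)^{\ell+\frac{\mu+3}{2}}}\left(\frac x2\right)^{2\ell+1}e^{\frac x2}\,\widetilde I_{\frac\mu2}\!\left(\frac{tx}{2(1-t)}\right)\widetilde K_{\ell+\frac12}\!\left(\frac{x}{2(1-t)}\right),$$ and $M_j^{\mu,\ell}(x)=\frac{\Gamma(j+\mu+1)}{j!\,2^\mu\,\Gamma(j+\frac{\mu+1}{2})}\left.\frac{\partial^j}{\partial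 t^j}\right|_{t=0}G^{\mu,\ell}(t,x)$. *)

theory Defs
  imports "HOL-Analysis.Analysis" "HOL-Computational_Algebra.Polynomial"
begin

definition laguerre :: "nat \<Rightarrow> complex \<Rightarrow> complex \<Rightarrow> complex" where
  "laguerre n \<alpha> z = (\<Sum>k=0..n. (-1)^k / fact k * ((of_nat n + \<alpha>) gchoose (n - k)) * z ^ k)"

text \<open>Normalized modified Bessel function of the first kind,
  I~_nu(z) = (z/2)^(-nu) I_nu(z) = sum_k (z/2)^(2k) / (k! Gamma(k+nu+1)),
  taken as the entire function given by its series (1/Gamma written as rGamma).\<close>
definition bessel_I_tilde :: "complex \<Rightarrow> complex \<Rightarrow> complex" where
  "bessel_I_tilde \<nu> z = (\<Sum>k. (z / 2) ^ (2 * k) * rGamma (of_nat k + \<nu> + 1) / fact k)"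

text \<open>Modified Bessel function of the second kind for Re z > 0, via its standard
  integral representation K_nu(z) = int_0^infty exp(-z cosh s) cosh(nu s) ds.\<close>
definition bessel_K :: "complex \<Rightarrow> complex \<Rightarrow> complex" where
  "bessel_K \<nu> z = integral {0..} (\<lambda>s::real. exp (- z * cosh (of_real s)) * cosh (\<nu> * of_real s))"

definition bessel_K_tilde :: "complex \<Rightarrow> complex \<Rightarrow> complex" where
  "bessel_K_tilde \<nu> z = (z / 2) powr (- \<nu>) * bessel_K \<nu> z"

definition G_fun :: "complex \<Rightarrow> nat \<Rightarrow> complex \<Rightarrow> real \<Rightarrow> complex" where
  "G_fun \<mu> l t x =
     (1 / (1 - t) powr (of_nat l + (\<mu> + 3) / 2)) * of_real ((x / 2) ^ (2 * l + 1)) * of_real (exp (x / 2))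
     * bessel_I_tilde (\<mu> / 2) (t * of_real x / (2 * (1 - t)))
     * bessel_K_tilde (of_nat l + 1 / 2) (of_real x / (2 * (1 - t)))"

definition M_fun :: "complex \<Rightarrow> nat \<Rightarrow> nat \<Rightarrow> real \<Rightarrow> complex" where
  "M_fun \<mu> l j x =
     Gamma (of_nat j + \<mu> + 1) / (fact j * 2 powr \<mu> * Gamma (of_nat j + (\<mu> + 1) / 2))
     * (deriv ^^ j) (\<lambda>t. G_fun \<mu> l t x) 0"

end

theory Submission
  imports Defs "HOL-Complex_Analysis.Complex_Analysis"
begin

text \<open>
  Multiplying by \<open>t ^ j\<close> and summing over \<open>j\<close> turns the Laguerre polynomial into
  \<open>(1 - t) powr (- \<alpha> - 1) * exp (s * y)\<close> with \<open>s = - t / (1 - t)\<close> and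
  \<open>y = x (cos \<psi> + cosh \<phi>)\<close>. The double integral then factors into Poisson's integral for
  \<open>I\<close> at \<open>x s\<close> and the corresponding integral for \<open>K\<close> at \<open>x (1 - s)\<close>.
  Everything is carried out coefficientwise: the Taylor coefficients of the two Bessel factors
  at \<open>s = 0\<close> are the moments of \<open>sin powr \<mu>\<close> and of the hyperbolic weight, and
  both sides of the identity are the same finite sum of products of such moments. The hyperbolic
  moments are polynomials in \<open>x\<close>, and the coefficient of \<open>x ^ (j + l)\<close> in the sum is a
  nonzero multiple of the integral of \<open>(1 + cos \<psi>) ^ j * sin \<psi> powr \<mu>\<close>, which a recursion
  in \<open>j\<close> shows to be nonzero. For complex \<open>\<mu>\<close> and complex Bessel arguments the required
  closed forms follow from the real ones by analytic continuation.
\<close>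

section \<open>Integrals depending on a parameter\<close>

text \<open>The difference is the integral of \<open>f\<close> over \<open>T - {a..b}\<close>, where
  \<open>h\<close> dominates. The bound does not involve \<open>f\<close>, so it is uniform over any
  family with the common majorant \<open>h\<close>.\<close>

lemma integral_Diff_bound:
  fixes f :: "real \<Rightarrow> complex"
  assumes f: "f absolutely_integrable_on T" and A: "{a..b} \<subseteq> T"
    and h: "h integrable_on T" and le: "\<And>t. t \<in> T \<Longrightarrow> norm (f t) \<le> h t"
  shows "norm (integral T f - integral {a..b} f) \<le> integral T h - integral {a..b} h"
proof -
  have hT: "h absolutely_integrable_on T"
    using h le by (intro nonnegative_absolutely_integrable_1) (auto intro: order_trans[OF norm_ge_zero])
  have hA: "h absolutely_integrable_on {a..b}" and fA: "f absolutely_integrable_on {a..b}"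
    using A by (auto intro: set_integrable_subset[OF hT] set_integrable_subset[OF f])
  have fD: "(f has_integral integral T f - integral {a..b} f) (T - {a..b})"
    and hD: "(h has_integral integral T h - integral {a..b} h) (T - {a..b})"
    using f h hA fA A
    by (auto intro!: has_integral_setdiff integrable_integral simp: absolutely_integrable_on_def)
  have "norm (integral (T - {a..b}) f) \<le> integral (T - {a..b}) h"
    using fD hD le by (intro integral_norm_bound_integral) auto
  then show ?thesis using fD hD by (simp add: integral_unique)
qed

text \<open>The truncated integrals over \<open>{a n..b n}\<close> are holomorphic by Leibniz's
  rule. A majorant valid on a whole disc makes them converge uniformly there, and Weierstrass's
  theorem passes holomorphy to the limit. Only \<open>f\<close> has to be dominated; for
  \<open>f'\<close> continuity suffices.\<close>

lemma holomorphic_improper_integral: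
  fixes f f' :: "complex \<Rightarrow> real \<Rightarrow> complex" and a b :: "nat \<Rightarrow> real"
  assumes U: "convex U" "open U"
    and mono: "incseq (\<lambda>n. {a n..b n})" and T: "T = (\<Union>n. {a n..b n})"
    and der: "\<And>z t. z \<in> U \<Longrightarrow> t \<in> T \<Longrightarrow> ((\<lambda>z. f z t) has_field_derivative f' z t) (at z)"
    and cf: "\<And>z. z \<in> U \<Longrightarrow> continuous_on T (f z)"
    and cf': "continuous_on (U \<times> T) (\<lambda>(z, t). f' z t)"
    and bound: "\<And>z. z \<in> U \<Longrightarrow> \<exists>d>0. \<exists>h. cball z d \<subseteq> U \<and> h integrable_on T \<and>
                   (\<forall>w\<in>cball z d. \<forall>t\<in>T. norm (f w t) \<le> h t)"
  shows "\<And>z. z \<in> U \<Longrightarrow> f z absolutely_integrable_on T"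
    and "(\<lambda>z. integral T (f z)) holomorphic_on U"
proof -
  have Tm: "T \<in> sets lebesgue" unfolding T by auto
  show ai: "f z absolutely_integrable_on T" if z: "z \<in> U" for z
  proof -
    obtain d h where dh: "d > 0" "h integrable_on T" "\<forall>w\<in>cball z d. \<forall>t\<in>T. norm (f w t) \<le> h t"
      using bound[OF z] by blast
    show ?thesis
      by (rule measurable_bounded_by_integrable_imp_absolutely_integrable[OF _ Tm dh(2)])
         (use dh Tm in \<open>auto intro!: continuous_imp_measurable_on_sets_lebesgue cf z\<close>)
  qed
  have AT: "{a n..b n} \<subseteq> T" for n unfolding T by auto
  then have TA: "{a n..b n} \<inter> T = {a n..b n}" for n by blast
  show "(\<lambda>z. integral T (f z)) holomorphic_on U"
  proof (rule holomorphic_uniform_sequence[OF U(2)])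
    fix n
    have "(\<lambda>z. integral (cbox (a n) (b n)) (f z)) holomorphic_on U"
    proof (rule leibniz_rule_holomorphic[where fx = f'])
      show "((\<lambda>z. f z t) has_field_derivative f' z t) (at z within U)"
        if "z \<in> U" "t \<in> cbox (a n) (b n)" for z t
        using der[OF that(1)] that(2) AT[of n] has_field_derivative_at_within by (metis box_real(2) subsetD)
      show "f z integrable_on cbox (a n) (b n)" if "z \<in> U" for z
        using cf[OF that] AT[of n] by (intro integrable_continuous) (auto intro: continuous_on_subset)
      show "continuous_on (U \<times> cbox (a n) (b n)) (\<lambda>(z, t). f' z t)"
        using AT[of n] by (intro continuous_on_subset[OF cf']) auto
    qed (use U in auto)
    then show "(\<lambda>z. integral {a n..b n} (f z)) holomorphic_on U" by simp
  next
    fix z assume z: "z \<in> U"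
    obtain d h where dh: "d > 0" "cball z d \<subseteq> U" "h integrable_on T"
        "\<forall>w\<in>cball z d. \<forall>t\<in>T. norm (f w t) \<le> h t"
      using bound[OF z] by blast
    have h0: "h t \<ge> 0" if "t \<in> T" for t
    proof -
      have "norm (f z t) \<le> h t" using dh(1,4) that by auto
      then show ?thesis by (rule order_trans[OF norm_ge_zero])
    qed
    have hT: "h absolutely_integrable_on T"
      using dh h0 by (intro nonnegative_absolutely_integrable_1) auto
    \<comment> \<open>The limit is taken for the majorant alone: its tails tend to 0, and they
      control the tails of \<open>f w\<close> for all \<open>w\<close> in the disc at once.\<close>
    have "(\<lambda>n. integral T (\<lambda>t. if t \<in> {a n..b n} then h t else 0)) \<longlonglongrightarrow> integral T h"
    proof (rule dominated_convergence[where h = h])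
      show "(\<lambda>t. if t \<in> {a n..b n} then h t else 0) integrable_on T" for n
        using set_integrable_subset[OF hT _ AT[of n]] AT[of n]
        by (subst integrable_restrict_Int) (auto simp: TA absolutely_integrable_on_def)
      show "(\<lambda>n. if t \<in> {a n..b n} then h t else 0) \<longlonglongrightarrow> h t" if t: "t \<in> T" for t
      proof -
        obtain N where "t \<in> {a N..b N}" using t unfolding T by blast
        then have "t \<in> {a n..b n}" if "n \<ge> N" for n
          using monoD[OF mono that] by blast
        then have "\<forall>\<^sub>F n in sequentially. (if t \<in> {a n..b n} then h t else 0) = h t"
          by (auto simp: eventually_sequentially)
        then show ?thesis by (rule tendsto_eventually)
      qed
    qed (use h0 dh in auto)
    also have "(\<lambda>n. integral T (\<lambda>t. if t \<in> {a n..b n} then h t else 0)) = (\<lambda>n. integral {a n..b n} h)"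
      by (intro ext, subst integral_restrict_Int) (simp add: TA)
    finally have lim: "(\<lambda>n. integral {a n..b n} h) \<longlonglongrightarrow> integral T h" .
    have "uniform_limit (cball z d) (\<lambda>n z. integral {a n..b n} (f z)) (\<lambda>z. integral T (f z)) sequentially"
      unfolding uniform_limit_iff
    proof (intro allI impI)
      fix e :: real assume "e > 0"
      with lim have "\<forall>\<^sub>F n in sequentially. dist (integral {a n..b n} h) (integral T h) < e"
        by (simp add: tendsto_iff)
      then show "\<forall>\<^sub>F n in sequentially. \<forall>w\<in>cball z d. dist (integral {a n..b n} (f w)) (integral T (f w)) < e"
      proof eventually_elim
        case (elim n)
        show ?case
        proof
          fix w assume w: "w \<in> cball z d"
          have "norm (integral T (f w) - integral {a n..b n} (f w)) \<le> integral T h - integral {a n..b n} h"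
            by (rule integral_Diff_bound) (use w dh AT in \<open>auto intro!: ai\<close>)
          also have "\<dots> < e" using elim by (auto simp: dist_real_def)
          finally show "dist (integral {a n..b n} (f w)) (integral T (f w)) < e"
            by (simp add: dist_norm norm_minus_commute)
        qed
      qed
    qed
    then show "\<exists>d. 0 < d \<and> cball z d \<subseteq> U \<and>
      uniform_limit (cball z d) (\<lambda>n z. integral {a n..b n} (f z)) (\<lambda>z. integral T (f z)) sequentially"
      using dh by blast
  qed
qed

text \<open>Change of variables with the transformed integrand named \<open>F\<close>, so that only
  a pointwise identity on \<open>S\<close> is left to check.\<close>

lemma
  fixes f F :: "real \<Rightarrow> 'a :: euclidean_space"
  assumes S: "S \<in> sets lebesgue" and der: "\<And>x. x \<in> S \<Longrightarrow> (g has_field_derivative g' x) (at x within S)"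
    and inj: "inj_on g S" and img: "g ` S = T"
    and f: "f absolutely_integrable_on T"
    and F: "\<And>x. x \<in> S \<Longrightarrow> F x = \<bar>g' x\<bar> *\<^sub>R f (g x)"
  shows absolutely_integrable_substitution: "F absolutely_integrable_on S"
    and integral_substitution_real: "integral S F = integral T f"
proof -
  have *: "(\<lambda>x. \<bar>g' x\<bar> *\<^sub>R f (g x)) absolutely_integrable_on S \<and>
       integral S (\<lambda>x. \<bar>g' x\<bar> *\<^sub>R f (g x)) = integral T f"
    by (rule iffD2[OF has_absolute_integral_change_of_variables_real[OF S der inj]]) (use f img in auto)
  show "F absolutely_integrable_on S"
    using * F by (simp cong: set_integrable_cong)
  show "integral S F = integral T f"
    using * F by (simp cong: integral_cong)
qed

section \<open>Moments of powers of the sine\<close>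

text \<open>Since \<open>S\<close> is open, real points of \<open>S\<close> accumulate at
  \<open>a\<close>, and the identity theorem applies on the connected set \<open>S\<close>.\<close>

lemma holomorphic_eq_from_reals:
  assumes S: "open S" "connected S" and f: "f holomorphic_on S" and g: "g holomorphic_on S"
    and a: "complex_of_real a \<in> S" and eq: "\<And>x. complex_of_real x \<in> S \<Longrightarrow> f (of_real x) = g (of_real x)"
    and z: "z \<in> S"
  shows "f z = g z"
proof -
  have "complex_of_real a islimpt (S \<inter> range complex_of_real)"
    unfolding islimpt_approachable
  proof (intro allI impI)
    fix e :: real assume "e > 0"
    obtain r where r: "r > 0" "ball (complex_of_real a) r \<subseteq> S"
      using S(1) a open_contains_ball by blast
    define d where "d = min e r / 2"
    have d: "0 < d" "d < e" "d < r" using \<open>e > 0\<close> r(1) by (auto simp: d_def)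
    have "dist (complex_of_real (a + d)) (complex_of_real a) = d"
      using d by (simp add: dist_norm)
    then show "\<exists>x'\<in>S \<inter> range complex_of_real. x' \<noteq> complex_of_real a \<and> dist x' (complex_of_real a) < e"
      using d r by (intro bexI[of _ "complex_of_real (a + d)"]) (auto simp: dist_commute simp del: of_real_add)
  qed
  from analytic_continuation[OF _ S Int_lower1 a this, of "\<lambda>z. f z - g z" z] f g eq z
  show ?thesis by (auto intro: holomorphic_on_diff)
qed

text \<open>The substitution y = (1 - cos t) / 2 has derivative sin t / 2 and satisfies y (1 - y) =
  (sin t / 2)^2, which turns the integral into a Beta integral with both exponents equal.\<close>

lemma sin_powr_real_integral:
  fixes s :: real
  assumes s: "s > -1"
  shows "(\<lambda>t. sin t powr s) absolutely_integrable_on {0<..<pi}"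
    and "integral {0<..<pi} (\<lambda>t. sin t powr s) = 2 powr s * Beta ((s + 1) / 2) ((s + 1) / 2)"
proof -
  let ?f = "\<lambda>y::real. 2 powr s * (y powr ((s + 1) / 2 - 1) * (1 - y) powr ((s + 1) / 2 - 1))"
  let ?g = "\<lambda>t::real. (1 - cos t) / 2"
  have img: "?g ` {0<..<pi} = {0<..<1}"
  proof (intro equalityI subsetI)
    fix y assume "y \<in> ?g ` {0<..<pi}"
    then obtain t where t: "0 < t" "t < pi" "y = ?g t" by auto
    then show "y \<in> {0<..<1}"
      using cos_monotone_0_pi[of 0 t] cos_monotone_0_pi[of t pi] by auto
  next
    fix y :: real assume y: "y \<in> {0<..<1}"
    then have "arccos (1 - 2 * y) \<in> {0<..<pi}" "?g (arccos (1 - 2 * y)) = y"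
      using arccos_lt_bounded[of "1 - 2 * y"] by (auto simp: cos_arccos)
    then show "y \<in> ?g ` {0<..<pi}" by (metis imageI)
  qed
  have "(?f has_integral 2 powr s * Beta ((s + 1) / 2) ((s + 1) / 2)) {0..1}"
    using s by (intro has_integral_mult_right has_integral_Beta_real) auto
  then have hi: "(?f has_integral 2 powr s * Beta ((s + 1) / 2) ((s + 1) / 2)) {0<..<1}"
    by (simp add: has_integral_Icc_iff_Ioo)
  then have ai: "?f absolutely_integrable_on {0<..<1}"
    by (intro nonnegative_absolutely_integrable_1) auto
  have eq: "sin t powr s = \<bar>sin t / 2\<bar> *\<^sub>R ?f (?g t)" if "t \<in> {0<..<pi}" for t
  proof -
    have st: "sin t > 0" using that by (auto intro: sin_gt_zero)
    define y where "y = ?g t"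
    have "y \<in> {0<..<1}" unfolding y_def img[symmetric] using that by (rule imageI)
    then have y: "0 < y" "y < 1" by auto
    have e: "(s + 1) / 2 - 1 = (s - 1) / 2" by (simp add: field_simps)
    have "y powr ((s + 1) / 2 - 1) * (1 - y) powr ((s + 1) / 2 - 1) = (y * (1 - y)) powr ((s - 1) / 2)"
      unfolding e using y by (simp add: powr_mult)
    also have "y * (1 - y) = (sin t / 2)\<^sup>2"
      unfolding power_divide sin_squared_eq by (simp add: y_def field_simps power2_eq_square)
    also have "\<dots> powr ((s - 1) / 2) = (sin t / 2) powr (s - 1)"
      using st by (simp add: powr_powr diff_divide_distrib flip: powr_numeral)
    finally have "\<bar>sin t / 2\<bar> *\<^sub>R ?f (?g t) = (sin t / 2) * (sin t / 2) powr (s - 1) * 2 powr s"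
      unfolding y_def using st by (simp only: abs_of_pos divide_pos_pos zero_less_numeral real_scaleR_def mult_ac)
    also have "(sin t / 2) * (sin t / 2) powr (s - 1) = (sin t / 2) powr s"
      using st powr_mult_base[of "sin t / 2" "s - 1"] by simp
    finally show ?thesis using st by (simp add: powr_divide)
  qed
  have der: "(?g has_field_derivative sin t / 2) (at t within {0<..<pi})" for t
    by (auto intro!: derivative_eq_intros)
  have inj: "inj_on ?g {0<..<pi}"
  proof (rule inj_onI)
    fix u v assume "u \<in> {0<..<pi}" "v \<in> {0<..<pi}" "?g u = ?g v"
    then show "u = v" using cos_inj_pi[of u v] by simp
  qed
  have m: "{0<..<pi} \<in> sets lebesgue" by simp
  note * = absolutely_integrable_substitution[OF m der inj img ai eq] integral_substitution_real[OF m der inj img ai eq]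
  show "(\<lambda>t. sin t powr s) absolutely_integrable_on {0<..<pi}" by (rule *(1))
  show "integral {0<..<pi} (\<lambda>t. sin t powr s) = 2 powr s * Beta ((s + 1) / 2) ((s + 1) / 2)"
    using *(2) integral_unique[OF hi] by (rule trans)
qed

text \<open>An exhaustion by compact intervals that avoid the endpoints, where powers of the sine
  with negative real exponent blow up.\<close>

lemma Ioo_0_pi_eq_Union: "{0<..<pi} = (\<Union>n. {inverse (real (Suc n))..pi - inverse (real (Suc n))})"
proof (intro equalityI subsetI)
  fix t assume t: "t \<in> {0<..<pi}"
  then have "0 < min t (pi - t)" by simp
  then obtain n where "inverse (real (Suc n)) < min t (pi - t)" using reals_Archimedean by blast
  then show "t \<in> (\<Union>n. {inverse (real (Suc n))..pi - inverse (real (Suc n))})"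
    by (intro UN_I[of n]) auto
next
  fix t assume "t \<in> (\<Union>n. {inverse (real (Suc n))..pi - inverse (real (Suc n))})"
  then obtain n where "inverse (real (Suc n)) \<le> t" "t \<le> pi - inverse (real (Suc n))" by auto
  moreover have "inverse (real (Suc n)) > 0" by simp
  ultimately show "t \<in> {0<..<pi}" by (simp only: greaterThanLessThan_iff) linarith
qed

lemma incseq_Icc_0_pi: "incseq (\<lambda>n. {inverse (real (Suc n))..pi - inverse (real (Suc n))})"
proof (intro incseq_SucI)
  fix n
  have "inverse (real (Suc (Suc n))) \<le> inverse (real (Suc n))" by (intro le_imp_inverse_le) auto
  then show "{inverse (real (Suc n))..pi - inverse (real (Suc n))}
    \<subseteq> {inverse (real (Suc (Suc n)))..pi - inverse (real (Suc (Suc n)))}" by auto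
qed

lemma norm_sin_powr: "t \<in> {0<..<pi} \<Longrightarrow> norm (complex_of_real (sin t) powr z) = sin t powr Re z"
  by (subst norm_powr_real_powr) (auto intro: sin_gt_zero less_imp_le)

lemma shows sin_powr_absolutely_integrable:
    "\<And>z. Re z > -1 \<Longrightarrow> (\<lambda>t. complex_of_real (sin t) powr z) absolutely_integrable_on {0<..<pi}"
  and sin_powr_integral_holomorphic:
    "(\<lambda>z. integral {0<..<pi} (\<lambda>t. complex_of_real (sin t) powr z)) holomorphic_on {z. Re z > -1}"
proof -
  let ?U = "{z::complex. Re z > -1}"
  have s0: "sin t > 0" if "t \<in> {0<..<pi}" for t using that by (auto intro: sin_gt_zero)
  have bd: "\<exists>d>0. \<exists>h. cball z d \<subseteq> ?U \<and> h integrable_on {0<..<pi} \<and>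
          (\<forall>w\<in>cball z d. \<forall>t\<in>{0<..<pi}. norm (complex_of_real (sin t) powr w) \<le> h t)" if z: "z \<in> ?U" for z
  proof (intro exI conjI ballI)
    \<comment> \<open>Half the distance to the line \<open>Re z = -1\<close>: on this disc the real
      part stays at least \<open>(Re z - 1) / 2\<close>, which is still above -1. As the sine is at
      most 1, the power with this smallest exponent dominates.\<close>
    let ?d = "(Re z + 1) / 2"
    show "?d > 0" using z by simp
    have Re: "Re w \<ge> (Re z - 1) / 2" if "w \<in> cball z ?d" for w
      using that abs_Re_le_cmod[of "z - w"] by (auto simp: dist_norm field_simps)
    show "cball z ?d \<subseteq> ?U" using Re z by fastforce
    show "(\<lambda>t. sin t powr ((Re z - 1) / 2)) integrable_on {0<..<pi}"
      using z by (intro set_lebesgue_integral_eq_integral(1) sin_powr_real_integral) simp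
    fix w t assume w: "w \<in> cball z ?d" and t: "t \<in> {0<..<pi}"
    show "norm (complex_of_real (sin t) powr w) \<le> sin t powr ((Re z - 1) / 2)"
      unfolding norm_sin_powr[OF t] using s0[OF t] Re[OF w] by (intro powr_mono') auto
  qed
  have der: "((\<lambda>z. complex_of_real (sin t) powr z) has_field_derivative
       complex_of_real (sin t) powr z * Ln (of_real (sin t))) (at z)" if "t \<in> {0<..<pi}" for z t
    using s0[OF that] by (auto intro!: derivative_eq_intros)
  have cf: "continuous_on {0<..<pi} (\<lambda>t. complex_of_real (sin t) powr z)" for z
    using s0 by (intro continuous_intros) (force simp: less_imp_le)+
  have cf': "continuous_on (?U \<times> {0<..<pi}) (\<lambda>(z,t). complex_of_real (sin t) powr z * Ln (of_real (sin t)))"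
    unfolding case_prod_unfold
    by (intro continuous_intros) (use s0 in \<open>force simp: less_imp_le complex_nonpos_Reals_iff\<close>)+
  note * = holomorphic_improper_integral[OF _ _ incseq_Icc_0_pi Ioo_0_pi_eq_Union,
      of ?U "\<lambda>z t. complex_of_real (sin t) powr z" "\<lambda>z t. complex_of_real (sin t) powr z * Ln (of_real (sin t))"]
  have U: "convex ?U" "open ?U" by (auto simp: convex_halfspace_Re_gt open_halfspace_Re_gt)
  show "(\<lambda>t. complex_of_real (sin t) powr z) absolutely_integrable_on {0<..<pi}" if "Re z > -1" for z
    by (rule *(1)[OF U der cf cf' bd]) (use that in auto)
  show "(\<lambda>z. integral {0<..<pi} (\<lambda>t. complex_of_real (sin t) powr z)) holomorphic_on {z. Re z > -1}"
    by (rule *(2)[OF U der cf cf' bd])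
qed

lemma Re_pos_not_nonpos_Int: "Re z > 0 \<Longrightarrow> z \<notin> \<int>\<^sub>\<le>\<^sub>0"
  by (auto elim!: nonpos_Ints_cases)

lemma pos_real_not_nonpos_Int: "y > 0 \<Longrightarrow> (y :: real) \<notin> \<int>\<^sub>\<le>\<^sub>0"
  by (auto elim!: nonpos_Ints_cases)

text \<open>For real exponents this is the Beta value rewritten by Legendre's duplication formula;
  complex exponents follow by continuation in \<open>z\<close>.\<close>

lemma sin_powr_integral:
  assumes z: "Re z > -1"
  shows "integral {0<..<pi} (\<lambda>t. complex_of_real (sin t) powr z)
       = of_real (sqrt pi) * Gamma ((z + 1) / 2) * rGamma (z / 2 + 1)"
proof (rule holomorphic_eq_from_reals[where S = "{z. Re z > -1}" and a = 0 and z = z])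
  show "(\<lambda>z. of_real (sqrt pi) * Gamma ((z + 1) / 2) * rGamma (z / 2 + 1)) holomorphic_on {z. Re z > -1}"
    using Re_pos_not_nonpos_Int[of "(z + 1) / 2" for z] by (intro holomorphic_intros) auto
  fix x :: real assume "complex_of_real x \<in> {z. Re z > -1}"
  then have x: "x > -1" by simp
  have "integral {0<..<pi} (\<lambda>t. complex_of_real (sin t) powr of_real x)
      = integral {0<..<pi} (\<lambda>t. complex_of_real (sin t powr x))"
    by (intro integral_cong powr_of_real) (auto intro!: sin_ge_zero)
  also have "\<dots> = of_real (2 powr x * Beta ((x + 1) / 2) ((x + 1) / 2))"
    using sin_powr_real_integral[OF x]
    by (intro integral_unique has_integral_of_real) (auto simp: has_integral_iff set_lebesgue_integral_eq_integral)
  also have "2 powr x * Beta ((x + 1) / 2) ((x + 1) / 2) = sqrt pi * Gamma ((x + 1) / 2) * rGamma (x / 2 + 1)"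
  proof -
    \<comment> \<open>With this \<open>a\<close> the duplication formula links exactly the Gamma
      values at hand: \<open>2 * a = x + 1\<close> and \<open>a + 1 / 2 = x / 2 + 1\<close>, with
      the constant 2^(1 - 2a) = 2^(-x).\<close>
    define a where "a = (x + 1) / 2"
    have "a > 0" using x by (simp add: a_def)
    then have pos: "a > 0" "a + 1 / 2 > 0" "x + 1 > 0" using x by auto
    have x_eq: "x = 2 * a - 1" by (simp add: a_def field_simps)
    have nz: "Gamma a \<noteq> 0" "Gamma (a + 1 / 2) \<noteq> 0" "Gamma (x + 1) \<noteq> 0"
      using pos[THEN pos_real_not_nonpos_Int] by (simp_all add: Gamma_eq_zero_iff)
    have "complex_of_real a \<notin> \<int>\<^sub>\<le>\<^sub>0" "complex_of_real a + 1 / 2 \<notin> \<int>\<^sub>\<le>\<^sub>0"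
      by (rule Re_pos_not_nonpos_Int, use pos in simp)+
    from Gamma_legendre_duplication[OF this]
    have "complex_of_real (Gamma a * Gamma (a + 1 / 2)) =
        of_real (exp ((1 - 2 * a) * ln 2) * sqrt pi * Gamma (2 * a))"
      using Gamma_complex_of_real[of a] Gamma_complex_of_real[of "a + 1 / 2"]
        Gamma_complex_of_real[of "2 * a"] exp_of_real[of "(1 - 2 * a) * ln 2", where 'a = complex]
      by simp
    then have "Gamma a * Gamma (a + 1 / 2) = exp ((1 - 2 * a) * ln 2) * sqrt pi * Gamma (2 * a)"
      using of_real_eq_iff by blast
    also have "exp ((1 - 2 * a) * ln 2) = 1 / 2 powr x"
      by (simp add: powr_def x_eq exp_minus[symmetric] inverse_eq_divide[symmetric] algebra_simps)
    finally have main: "2 powr x * Gamma a * Gamma (a + 1 / 2) = sqrt pi * Gamma (x + 1)"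
      by (simp add: field_simps x_eq)
    have e: "a + a = x + 1" "x / 2 + 1 = a + 1 / 2" by (simp_all add: x_eq field_simps)
    have "2 powr x * (Gamma a * Gamma a / Gamma (x + 1)) = 2 powr x * Gamma a * Gamma (a + 1 / 2) * Gamma a / (Gamma (x + 1) * Gamma (a + 1 / 2))"
      using nz by simp
    also have "\<dots> = sqrt pi * Gamma a * inverse (Gamma (a + 1 / 2))"
    proof -
      have "s * X * G / (X * H) = s * G * inverse H" if "X \<noteq> 0" for s X G H :: real
        using that by (simp add: field_simps)
      from this[OF nz(3)] show ?thesis unfolding main .
    qed
    finally show ?thesis
      unfolding a_def[symmetric] Beta_def rGamma_inverse_Gamma e .
  qed
  finally show "integral {0<..<pi} (\<lambda>t. complex_of_real (sin t) powr of_real x)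
       = of_real (sqrt pi) * Gamma ((of_real x + 1) / 2) * rGamma (of_real x / 2 + 1)"
    using Gamma_complex_of_real[of "(x + 1) / 2"] rGamma_complex_of_real[of "x / 2 + 1"] by simp
qed (use z sin_powr_integral_holomorphic in \<open>auto simp: open_halfspace_Re_gt convex_halfspace_Re_gt convex_connected\<close>)

section \<open>Integrals of polynomials in the cosine against a power of the sine\<close>

text \<open>Encoding the integrand by a polynomial makes the integral a linear functional, so that
  each recursion between moments reduces to a polynomial identity.\<close>

definition sin_int :: "complex \<Rightarrow> complex poly \<Rightarrow> complex" where
  "sin_int \<mu> P = integral {0..pi} (\<lambda>t. poly P (of_real (cos t)) * of_real (sin t) powr \<mu>)"

lemma sin_int_integrable:
  assumes "Re \<mu> > -1"
  shows "(\<lambda>t. poly P (of_real (cos t)) * of_real (sin t) powr \<mu>) absolutely_integrable_on {0..pi}"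
proof -
  have "(\<lambda>t. complex_of_real (sin t) powr \<mu>) absolutely_integrable_on {0..pi}"
    using sin_powr_absolutely_integrable[OF assms] unfolding absolutely_integrable_on_def
    by (simp add: integrable_on_Icc_iff_Ioo)
  moreover have c: "continuous_on {0..pi} (\<lambda>t. poly P (complex_of_real (cos t)))"
    by (intro continuous_intros)
  moreover have "bounded ((\<lambda>t. poly P (complex_of_real (cos t))) ` {0..pi})"
    by (intro compact_imp_bounded compact_continuous_image c) auto
  ultimately show ?thesis
    by (intro absolutely_integrable_bounded_measurable_product[OF bilinear_times])
       (auto intro!: continuous_imp_measurable_on_sets_lebesgue)
qed

lemma sin_int_has_integral:
  assumes "Re \<mu> > -1"
  shows "((\<lambda>t. poly P (of_real (cos t)) * of_real (sin t) powr \<mu>) has_integral sin_int \<mu> P) {0..pi}"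
  unfolding sin_int_def using sin_int_integrable[OF assms] by (simp add: absolutely_integrable_on_def integrable_integral)

lemma sin_int_0 [simp]: "sin_int \<mu> 0 = 0" by (simp add: sin_int_def)

lemma sin_int_add: "Re \<mu> > -1 \<Longrightarrow> sin_int \<mu> (P + Q) = sin_int \<mu> P + sin_int \<mu> Q"
  using has_integral_add[OF sin_int_has_integral sin_int_has_integral, of \<mu> \<mu> P Q]
  by (simp add: sin_int_def algebra_simps integral_unique)

lemma sin_int_smult: "Re \<mu> > -1 \<Longrightarrow> sin_int \<mu> (smult c P) = c * sin_int \<mu> P"
  using has_integral_mult_right[OF sin_int_has_integral[of \<mu> P], of c]
  by (simp add: sin_int_def algebra_simps integral_unique)

lemma sin_int_diff: "Re \<mu> > -1 \<Longrightarrow> sin_int \<mu> (P - Q) = sin_int \<mu> P - sin_int \<mu> Q"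
  using sin_int_add[of \<mu> P "smult (-1) Q"] sin_int_smult[of \<mu> "-1" Q] by simp

lemma sin_int_sum: "Re \<mu> > -1 \<Longrightarrow> sin_int \<mu> (\<Sum>i\<in>A. P i) = (\<Sum>i\<in>A. sin_int \<mu> (P i))"
  by (induction A rule: infinite_finite_induct) (auto simp: sin_int_add)

lemma sin_int_1:
  assumes "Re \<mu> > -1"
  shows "sin_int \<mu> 1 = of_real (sqrt pi) * Gamma ((\<mu> + 1) / 2) * rGamma (\<mu> / 2 + 1)"
  using sin_powr_integral[OF assms] by (simp add: sin_int_def integral_open_interval_real)

text \<open>Integrates the derivative of \<open>P (cos t) * sin t powr (\<mu> + 1)\<close>, which vanishes at both endpoints.\<close>
lemma sin_int_by_parts:
  assumes \<mu>: "Re \<mu> > -1"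
  shows "sin_int \<mu> ([:0, \<mu> + 1:] * P - [:1, 0, -1:] * pderiv P) = 0"
proof -
  let ?f = "\<lambda>t. poly P (of_real (cos t)) * complex_of_real (sin t) powr (\<mu> + 1)"
  let ?f' = "\<lambda>t. poly ([:0, \<mu> + 1:] * P - [:1, 0, -1:] * pderiv P) (of_real (cos t)) * complex_of_real (sin t) powr \<mu>"
  have "(?f' has_integral (?f pi - ?f 0)) {0..pi}"
  proof (rule fundamental_theorem_of_calculus_interior)
    show "continuous_on {0..pi} ?f"
      using \<mu> by (intro continuous_intros) (auto intro: sin_ge_zero)
    fix t assume t: "t \<in> {0<..<pi}"
    then have s: "sin t > 0" by (auto intro: sin_gt_zero)
    have sn: "complex_of_real (sin t) \<notin> \<real>\<^sub>\<le>\<^sub>0" using s by simp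
    have "((\<lambda>z. poly P (cos z) * sin z powr (\<mu> + 1)) has_field_derivative
       (poly (pderiv P) (cos z) * (- sin z) * sin z powr (\<mu> + 1) + poly P (cos z) * ((\<mu> + 1) * sin z powr \<mu> * cos z)))
       (at z)" if "z = complex_of_real t" for z
      using sn that by (auto intro!: derivative_eq_intros poly_DERIV[THEN DERIV_chain2] simp: sin_of_real)
    from this[OF refl] have "((\<lambda>z. poly P (cos z) * sin z powr (\<mu> + 1)) has_field_derivative ?f' t) (at (complex_of_real t))"
    proof (rule back_subst[where P = "\<lambda>d. (_ has_field_derivative d) _"])
      have "complex_of_real (sin t) powr (\<mu> + 1) = complex_of_real (sin t) powr \<mu> * of_real (sin t)"
        using s by (simp add: powr_add)
      moreover have "(complex_of_real (sin t))\<^sup>2 = 1 - (complex_of_real (cos t))\<^sup>2"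
        by (metis of_real_1 of_real_diff of_real_power sin_squared_eq)
      ultimately show "poly (pderiv P) (cos (of_real t)) * (- sin (of_real t)) * sin (of_real t) powr (\<mu> + 1)
          + poly P (cos (of_real t)) * ((\<mu> + 1) * sin (of_real t) powr \<mu> * cos (of_real t)) = ?f' t"
        by (simp add: sin_of_real cos_of_real power2_eq_square) algebra
    qed
    from has_vector_derivative_real_field[OF this] show "(?f has_vector_derivative ?f' t) (at t)"
      by (simp add: sin_of_real cos_of_real)
  qed simp
  then show ?thesis using \<mu> by (auto simp: sin_int_def dest!: integral_unique)
qed

lemma sin_int_monom_1: "Re \<mu> > -1 \<Longrightarrow> sin_int \<mu> (monom 1 1) = 0"
proof -
  assume \<mu>: "Re \<mu> > -1"
  have "[:0, \<mu> + 1:] * 1 - [:1, 0, -1:] * pderiv 1 = smult (\<mu> + 1) (monom 1 1)"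
    by (simp add: monom_altdef)
  then have "(\<mu> + 1) * sin_int \<mu> (monom 1 1) = 0"
    using sin_int_by_parts[OF \<mu>, of 1] sin_int_smult[OF \<mu>] by metis
  moreover have "\<mu> + 1 \<noteq> 0" using \<mu> by (auto simp: complex_eq_iff)
  ultimately show ?thesis by simp
qed

text \<open>Integration by parts applied to the monomial of degree \<open>a + 1\<close>. The step of
  two keeps parities apart: odd moments inherit 0 from the first one, even moments follow from the
  total mass.\<close>

lemma sin_int_monom_Suc_Suc:
  assumes \<mu>: "Re \<mu> > -1"
  shows "(of_nat a + 2 + \<mu>) * sin_int \<mu> (monom 1 (a + 2)) = (of_nat a + 1) * sin_int \<mu> (monom 1 a)"
proof -
  have "[:0, \<mu> + 1:] * monom 1 (a + 1) - [:1, 0, -1:] * pderiv (monom 1 (a + 1))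
      = smult (of_nat a + 2 + \<mu>) (monom 1 (a + 2)) - smult (of_nat a + 1) (monom 1 a)"
    by (rule poly_ext) (simp add: pderiv_monom poly_monom algebra_simps)
  then show ?thesis
    using sin_int_by_parts[OF \<mu>, of "monom 1 (a + 1)"] by (simp add: sin_int_diff sin_int_smult \<mu>)
qed

lemma sin_int_monom_odd: "Re \<mu> > -1 \<Longrightarrow> sin_int \<mu> (monom 1 (2 * k + 1)) = 0"
proof (induction k)
  case (Suc k)
  have "of_nat (2 * k + 1) + 2 + \<mu> \<noteq> 0" using Suc.prems by (auto simp: complex_eq_iff)
  then show ?case using Suc sin_int_monom_Suc_Suc[of \<mu> "2 * k + 1"] by simp
qed (use sin_int_monom_1 in simp)

text \<open>After division by \<open>fact (2 * k)\<close> these are the Taylor coefficients of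
  \<open>bessel_I_tilde (\<mu> / 2)\<close>, up to the constant
  \<open>sqrt pi * Gamma ((\<mu> + 1) / 2)\<close>.\<close>

lemma sin_int_monom_even:
  assumes \<mu>: "Re \<mu> > -1"
  shows "sin_int \<mu> (monom 1 (2 * k)) = of_real (sqrt pi) * Gamma ((\<mu> + 1) / 2)
           * (fact (2 * k) / (4 ^ k * fact k)) * rGamma (of_nat k + \<mu> / 2 + 1)"
proof (induction k)
  case 0
  then show ?case using sin_int_1[OF \<mu>] by (simp flip: one_pCons add: monom_0)
next
  case (Suc k)
  have nz: "of_nat (2 * k) + 2 + \<mu> \<noteq> 0" using \<mu> by (auto simp: complex_eq_iff)
  have r: "rGamma (of_nat k + \<mu> / 2 + 1) = (of_nat k + \<mu> / 2 + 1) * rGamma (of_nat (Suc k) + \<mu> / 2 + 1)"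
    using rGamma_plus1[of "of_nat k + \<mu> / 2 + 1"] by (simp add: add_ac)
  have "(of_nat (2 * k) + 2 + \<mu>) * sin_int \<mu> (monom 1 (2 * Suc k)) = of_nat (2 * k + 1) * sin_int \<mu> (monom 1 (2 * k))"
    using sin_int_monom_Suc_Suc[OF \<mu>, of "2 * k"] by (simp add: add_ac)
  also have "\<dots> = (of_nat (2 * k) + 2 + \<mu>) * (of_real (sqrt pi) * Gamma ((\<mu> + 1) / 2)
           * (fact (2 * Suc k) / (4 ^ Suc k * fact (Suc k))) * rGamma (of_nat (Suc k) + \<mu> / 2 + 1))"
    unfolding Suc.IH r by (simp add: divide_simps del: of_nat_Suc) (simp add: algebra_simps)
  finally show ?case unfolding mult_cancel_left using nz by blast
qed

text \<open>Integration by parts with P = (1 + X)^j. Since 1 - X^2 = (1 + X) (2 - (1 + X)), the term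
  (1 - X^2) P' equals 2 j P - j (1 + X) P, so only two consecutive powers occur.\<close>

lemma sin_int_one_plus_cos_power:
  assumes \<mu>: "Re \<mu> > -1"
  shows "(of_nat j + \<mu> + 1) * sin_int \<mu> ([:1, 1:] ^ Suc j) = (2 * of_nat j + \<mu> + 1) * sin_int \<mu> ([:1, 1:] ^ j)"
proof -
  have "[:0, \<mu> + 1:] * [:1, 1:] ^ j - [:1, 0, -1:] * pderiv ([:1, 1:] ^ j)
      = smult (of_nat j + \<mu> + 1) ([:1, 1:] ^ Suc j) - smult (2 * of_nat j + \<mu> + 1) ([:1, 1:] ^ j)"
  proof (cases j)
    case 0
    then show ?thesis by (simp add: pderiv_1 flip: smult_diff_right)
  next
    case (Suc i)
    show ?thesis unfolding Suc
      by (rule poly_ext) (simp only: pderiv_power_Suc, simp add: pderiv_pCons algebra_simps)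
  qed
  then show ?thesis
    using sin_int_by_parts[OF \<mu>, of "[:1, 1:] ^ j"] by (simp only: sin_int_diff sin_int_smult \<mu>) simp
qed

lemma sin_int_one_plus_cos_power_nonzero:
  assumes \<mu>: "Re \<mu> > -1"
  shows "sin_int \<mu> ([:1, 1:] ^ j) \<noteq> 0"
proof (induction j)
  case 0
  have "(\<mu> + 1) / 2 \<notin> \<int>\<^sub>\<le>\<^sub>0" "\<mu> / 2 + 1 \<notin> \<int>\<^sub>\<le>\<^sub>0" using \<mu> by (auto intro!: Re_pos_not_nonpos_Int)
  then show ?case using sin_int_1[OF \<mu>] by (simp add: Gamma_eq_zero_iff rGamma_eq_zero_iff)
next
  case (Suc j)
  have "2 * of_nat j + \<mu> + 1 \<noteq> 0" using \<mu> by (auto simp: complex_eq_iff)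
  then show ?case using Suc sin_int_one_plus_cos_power[OF \<mu>, of j] by auto
qed

text \<open>Powers of the cosine have modulus at most 1. A bound independent of \<open>a\<close>
  makes the moment series converge for every argument.\<close>

lemma norm_sin_int_monom_le:
  assumes \<mu>: "Re \<mu> > -1"
  obtains C where "\<And>a. norm (sin_int \<mu> (monom 1 a)) \<le> C"
proof
  fix a
  have "(\<lambda>t. norm (complex_of_real (sin t) powr \<mu>)) integrable_on {0..pi}"
    using sin_int_integrable[OF \<mu>, of 1] by (simp add: absolutely_integrable_on_def)
  then show "norm (sin_int \<mu> (monom 1 a)) \<le> integral {0..pi} (\<lambda>t. norm (complex_of_real (sin t) powr \<mu>))"
    unfolding sin_int_def
    by (intro integral_norm_bound_integral has_integral_integrable[OF sin_int_has_integral[OF \<mu>]])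
       (auto simp: poly_monom norm_mult norm_power intro!: mult_left_le_one_le power_le_one)
qed

text \<open>Poisson's integral in expanded form: the left side is the termwise integral of exp(z cos
  t) against the power of the sine. Odd terms vanish and even terms match the Bessel series.\<close>

lemma bessel_I_tilde_sums:
  assumes \<mu>: "Re \<mu> > -1"
  shows "(\<lambda>a. sin_int \<mu> (monom 1 a) / fact a * z ^ a) sums
           (of_real (sqrt pi) * Gamma ((\<mu> + 1) / 2) * bessel_I_tilde (\<mu> / 2) z)"
proof -
  let ?f = "\<lambda>a. sin_int \<mu> (monom 1 a) / fact a * z ^ a"
  let ?b = "\<lambda>k. (z / 2) ^ (2 * k) * rGamma (of_nat k + \<mu> / 2 + 1) / fact k"
  define K where "K = of_real (sqrt pi) * Gamma ((\<mu> + 1) / 2)"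
  have K: "K \<noteq> 0"
    using \<mu> Re_pos_not_nonpos_Int[of "(\<mu> + 1) / 2"] unfolding K_def by (simp add: Gamma_eq_zero_iff)
  obtain C where C: "\<And>a. norm (sin_int \<mu> (monom 1 a)) \<le> C"
    using norm_sin_int_monom_le[OF \<mu>] by blast
  have "summable ?f"
  proof (rule summable_comparison_test)
    have "norm (?f a) \<le> C * (inverse (fact a) * norm z ^ a)" for a
    proof -
      have "norm (?f a) = norm (sin_int \<mu> (monom 1 a)) * (inverse (fact a) * norm z ^ a)"
        by (simp add: norm_mult norm_divide norm_power divide_simps)
      also have "\<dots> \<le> C * (inverse (fact a) * norm z ^ a)"
        by (intro mult_right_mono C) auto
      finally show ?thesis .
    qed
    then show "\<exists>N. \<forall>a\<ge>N. norm (?f a) \<le> C * (inverse (fact a) * norm z ^ a)" by blast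
    show "summable (\<lambda>a. C * (inverse (fact a) * norm z ^ a))"
      by (intro summable_mult summable_exp)
  qed
  then have "?f sums (\<Sum>a. ?f a)" by (rule summable_sums)
  moreover have "?f a = 0" if "a \<notin> range (\<lambda>k. 2 * k)" for a
  proof -
    have "odd a" using that by (auto elim!: evenE)
    then show ?thesis using sin_int_monom_odd[OF \<mu>] by (auto elim!: oddE)
  qed
  ultimately have "(\<lambda>k. ?f (2 * k)) sums (\<Sum>a. ?f a)"
    by (subst sums_mono_reindex) (auto simp: strict_mono_def)
  also have "(\<lambda>k. ?f (2 * k)) = (\<lambda>k. K * ?b k)"
  proof
    fix k
    have "(z / 2) ^ (2 * k) = z ^ (2 * k) / 4 ^ k" by (simp add: power_mult power_divide)
    then show "?f (2 * k) = K * ?b k"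
      unfolding sin_int_monom_even[OF \<mu>] K_def by simp
  qed
  finally have 1: "(\<lambda>k. K * ?b k) sums (\<Sum>a. ?f a)" .
  \<comment> \<open>Convergence of the Bessel series is inherited from the moment series, since the
    factor \<open>K\<close> is nonzero; it allows \<open>K\<close> to be pulled out of the infinite
    sum.\<close>
  then have "summable ?b" using K unfolding sums_iff summable_cmult_iff by blast
  from trans[OF sums_unique[OF 1] suminf_mult[OF this]] have "(\<Sum>a. ?f a) = K * bessel_I_tilde (\<mu> / 2) z"
    unfolding bessel_I_tilde_def .
  with \<open>?f sums _\<close> show ?thesis by (simp add: K_def)
qed

text \<open>Evenness absorbs the sign of s = - t / (1 - t) relative to the argument used in
  \<open>G_fun\<close>.\<close>

lemma bessel_I_tilde_minus: "bessel_I_tilde \<nu> (- z) = bessel_I_tilde \<nu> z"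
  by (simp add: bessel_I_tilde_def)

section \<open>Hyperbolic moments\<close>

lemma has_integral_Ici_iff_Ioi:
  "(f has_integral y) {a::real..} \<longleftrightarrow> (f has_integral (y :: 'a :: banach)) {a<..}"
  by (rule has_integral_spike_set_eq) (rule negligible_subset[of "{a}"], auto)+

text \<open>Euler's integral under y = x (cosh s - 1). Integer \<open>p\<close> serves the
  hyperbolic moments, half-integer \<open>p\<close> the function K.\<close>

lemma cosh_substitution_Gamma:
  fixes x p :: real
  assumes x: "x > 0" and p: "p > 0"
  shows "((\<lambda>s. x * sinh s * ((x * (cosh s - 1)) powr (p - 1) / exp (x * (cosh s - 1)))) has_integral Gamma p) {0<..}"
    (is "(?F has_integral _) _")
proof -
  let ?f = "\<lambda>t::real. t powr (p - 1) / exp t"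
  let ?g = "\<lambda>s::real. x * (cosh s - 1)"
  have hi: "(?f has_integral Gamma p) {0<..}"
    using Gamma_integral_real[OF p] by (simp add: has_integral_Ici_iff_Ioi)
  then have ai: "?f absolutely_integrable_on {0<..}"
    by (intro nonnegative_absolutely_integrable_1) auto
  have img: "?g ` {0<..} = {0<..}"
  proof (intro equalityI subsetI)
    fix y assume "y \<in> ?g ` {0<..}"
    then show "y \<in> {0<..}" using x by (auto simp: cosh_real_strict_mono cosh_real_ge_1 order.strict_iff_order)
  next
    fix y :: real assume y: "y \<in> {0<..}"
    define s where "s = arcosh (y / x + 1)"
    have "y / x > 0" using x y by simp
    then have c: "cosh s = y / x + 1" "s \<ge> 0" unfolding s_def by (auto intro: cosh_arcosh_real)
    then have "s \<noteq> 0" using \<open>y / x > 0\<close> by auto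
    with c have "?g s = y" "s \<in> {0<..}" using x by auto
    then show "y \<in> ?g ` {0<..}" by (metis imageI)
  qed
  have inj: "inj_on ?g {0<..}"
    using x by (auto intro!: inj_onI)
  have der: "(?g has_field_derivative x * sinh s) (at s within {0<..})" for s
    by (auto intro!: derivative_eq_intros)
  have eq: "?F s = \<bar>x * sinh s\<bar> *\<^sub>R ?f (?g s)" if "s \<in> {0<..}" for s
    using that x by (simp add: abs_mult)
  have m: "{0::real<..} \<in> sets lebesgue" by simp
  note * = absolutely_integrable_substitution[OF m der inj img ai eq] integral_substitution_real[OF m der inj img ai eq]
  show ?thesis
    unfolding has_integral_iff
    using set_lebesgue_integral_eq_integral(1)[OF *(1)] trans[OF *(2) integral_unique[OF hi]] by (rule conjI)
qed

text \<open>With \<open>y = x (cosh s - 1)\<close> one has \<open>(x sinh s)\<^sup>2 = y (y + 2 x)\<close> and \<open>x cosh s = y + x\<close>, so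
  the hyperbolic moments reduce by binomial expansion to integrals of \<open>y ^ n * exp (- y)\<close>.\<close>
definition hyp_moment :: "real \<Rightarrow> nat \<Rightarrow> nat \<Rightarrow> real" where
  "hyp_moment x l b = (\<Sum>k\<le>l. \<Sum>i\<le>b. real (l choose k) * (2 * x) ^ (l - k) * (real (b choose i) * x ^ (b - i)) * fact (l + k + i))"

lemma hyp_moment_has_integral:
  assumes x: "x > 0"
  shows "((\<lambda>s. x ^ (2 * l + 1) * (exp (- x * (cosh s - 1)) * (x * cosh s) ^ b * sinh s ^ (2 * l + 1)))
            has_integral hyp_moment x l b) {0..}"
proof -
  have 1: "((\<lambda>s. x * sinh s * ((x * (cosh s - 1)) ^ n / exp (x * (cosh s - 1)))) has_integral fact n) {0..}" for n
  proof -
    have "((\<lambda>s. x * sinh s * ((x * (cosh s - 1)) powr (real (Suc n) - 1) / exp (x * (cosh s - 1)))) has_integral Gamma (real (Suc n))) {0<..}"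
      by (rule cosh_substitution_Gamma[OF x]) simp
    also have "Gamma (real (Suc n)) = fact n" using Gamma_fact[of n, where 'a = real] by (simp add: add_ac)
    finally show ?thesis unfolding has_integral_Ici_iff_Ioi
      by (rule has_integral_eq[rotated]) (use x in \<open>simp add: powr_realpow cosh_real_ge_1 order.strict_iff_order\<close>)
  qed
  have "((\<lambda>s. \<Sum>k\<le>l. \<Sum>i\<le>b. real (l choose k) * (2 * x) ^ (l - k) * (real (b choose i) * x ^ (b - i)) *
      (x * sinh s * ((x * (cosh s - 1)) ^ (l + k + i) / exp (x * (cosh s - 1)))))
      has_integral hyp_moment x l b) {0..}"
    unfolding hyp_moment_def by (intro has_integral_sum has_integral_mult_right 1) auto
  also have "(\<lambda>s. \<Sum>k\<le>l. \<Sum>i\<le>b. real (l choose k) * (2 * x) ^ (l - k) * (real (b choose i) * x ^ (b - i)) *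
      (x * sinh s * ((x * (cosh s - 1)) ^ (l + k + i) / exp (x * (cosh s - 1)))))
     = (\<lambda>s. x ^ (2 * l + 1) * (exp (- x * (cosh s - 1)) * (x * cosh s) ^ b * sinh s ^ (2 * l + 1)))"
  proof
    fix s :: real
    define y where "y = x * (cosh s - 1)"
    have "(\<Sum>k\<le>l. \<Sum>i\<le>b. real (l choose k) * (2 * x) ^ (l - k) * (real (b choose i) * x ^ (b - i)) *
        (x * sinh s * (y ^ (l + k + i) / exp y)))
      = x * sinh s * exp (- y) * y ^ l * ((\<Sum>k\<le>l. real (l choose k) * y ^ k * (2 * x) ^ (l - k)) *
         (\<Sum>i\<le>b. real (b choose i) * y ^ i * x ^ (b - i)))"
      by (subst sum_product, subst sum_distrib_left, intro sum.cong refl, subst sum_distrib_left, intro sum.cong refl)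
         (simp add: power_add exp_minus field_simps)
    also have "\<dots> = x * sinh s * exp (- y) * (y * (y + 2 * x)) ^ l * (y + x) ^ b"
      by (simp add: binomial_ring power_mult_distrib)
    also have "y * (y + 2 * x) = x\<^sup>2 * (sinh s)\<^sup>2"
      by (unfold sinh_square_eq y_def, simp add: power2_eq_square algebra_simps)
    also have "y + x = x * cosh s" by (simp add: y_def algebra_simps)
    also have "x * sinh s * exp (- y) * (x\<^sup>2 * (sinh s)\<^sup>2) ^ l * (x * cosh s) ^ b
       = x ^ (2 * l + 1) * (exp (- x * (cosh s - 1)) * (x * cosh s) ^ b * sinh s ^ (2 * l + 1))"
      by (simp add: y_def power_mult_distrib flip: power_mult)
    finally show "(\<Sum>k\<le>l. \<Sum>i\<le>b. real (l choose k) * (2 * x) ^ (l - k) * (real (b choose i) * x ^ (b - i)) *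
        (x * sinh s * ((x * (cosh s - 1)) ^ (l + k + i) / exp (x * (cosh s - 1)))))
       = x ^ (2 * l + 1) * (exp (- x * (cosh s - 1)) * (x * cosh s) ^ b * sinh s ^ (2 * l + 1))"
      by (simp only: y_def)
  qed
  finally show ?thesis .
qed

section \<open>Bessel functions of half-integer order\<close>

lemma Gamma_half_plus_nat: "Gamma (real k + 1 / 2) = sqrt pi * fact (2 * k) / (4 ^ k * fact k)"
proof (induction k)
  case (Suc k)
  have "Gamma (real (Suc k) + 1 / 2) = (real k + 1 / 2) * Gamma (real k + 1 / 2)"
    using Gamma_plus1[of "real k + 1 / 2"] pos_real_not_nonpos_Int[of "real k + 1 / 2"] by (simp add: add_ac)
  also have "\<dots> = sqrt pi * fact (2 * Suc k) / (4 ^ Suc k * fact (Suc k))"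
    unfolding Suc.IH by (simp add: divide_simps del: of_nat_Suc) (simp add: algebra_simps)
  finally show ?case .
qed (simp add: Gamma_one_half_real)

text \<open>The Morgan-Voyce polynomial, that is, the Chebyshev polynomial of the third kind
  evaluated at 1 + u / 2.\<close>

definition half_cosh_poly :: "nat \<Rightarrow> real \<Rightarrow> real" where
  "half_cosh_poly l u = (\<Sum>k\<le>l. real (l + k choose (2 * k)) * u ^ k)"

text \<open>Brings polynomials of different index to one summation range for termwise comparison;
  the added binomials vanish because \<open>l + k < 2 * k\<close> once \<open>k > l\<close>.\<close>

lemma half_cosh_poly_shift:
  assumes "l \<le> Suc N"
  shows "half_cosh_poly l u = 1 + (\<Sum>k\<le>N. real (l + Suc k choose (2 * Suc k)) * u ^ Suc k)"
proof -
  have "half_cosh_poly l u = (\<Sum>k\<le>Suc N. real (l + k choose (2 * k)) * u ^ k)"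
    unfolding half_cosh_poly_def using assms by (intro sum.mono_neutral_left) (auto intro: binomial_eq_0)
  then show ?thesis by (subst (asm) sum.atMost_Suc_shift) simp
qed

lemma half_cosh_poly_Suc_Suc:
  "half_cosh_poly (Suc (Suc l)) u = (2 + u) * half_cosh_poly (Suc l) u - half_cosh_poly l u"
proof -
  have "real (Suc (Suc l) + Suc k choose (2 * Suc k)) =
      2 * real (Suc l + Suc k choose (2 * Suc k)) + real (Suc l + k choose (2 * k)) - real (l + Suc k choose (2 * Suc k))" for k
    by simp
  then have A: "(\<Sum>k\<le>Suc l. real (Suc (Suc l) + Suc k choose (2 * Suc k)) * u ^ Suc k)
     = 2 * (\<Sum>k\<le>Suc l. real (Suc l + Suc k choose (2 * Suc k)) * u ^ Suc k)
       + u * half_cosh_poly (Suc l) u - (\<Sum>k\<le>Suc l. real (l + Suc k choose (2 * Suc k)) * u ^ Suc k)"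
    unfolding half_cosh_poly_def sum_distrib_left sum.distrib[symmetric] sum_subtractf[symmetric]
    by (intro sum.cong refl) (simp only:, simp add: algebra_simps)
  have B: "half_cosh_poly (Suc (Suc l)) u = 1 + (\<Sum>k\<le>Suc l. real (Suc (Suc l) + Suc k choose (2 * Suc k)) * u ^ Suc k)"
    "half_cosh_poly (Suc l) u = 1 + (\<Sum>k\<le>Suc l. real (Suc l + Suc k choose (2 * Suc k)) * u ^ Suc k)"
    "half_cosh_poly l u = 1 + (\<Sum>k\<le>Suc l. real (l + Suc k choose (2 * Suc k)) * u ^ Suc k)"
    by (rule half_cosh_poly_shift, simp)+
  have "A = 2 * B + u * q1 - C \<Longrightarrow> q2 = 1 + A \<Longrightarrow> q1 = 1 + B \<Longrightarrow> q0 = 1 + C \<Longrightarrow> q2 = (2 + u) * q1 - q0"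
    for A B C q0 q1 q2 :: real by (simp add: algebra_simps)
  from this[OF A B] show ?thesis .
qed

text \<open>Both sides satisfy the same three-term recursion in \<open>l\<close>: cosh(a + s) +
  cosh(a - s) = 2 cosh s cosh a, and 2 cosh s = 2 + u for u = 4 sinh(s / 2)^2.\<close>

lemma cosh_half_odd: "cosh ((real l + 1 / 2) * s) = cosh (s / 2) * half_cosh_poly l (4 * (sinh (s / 2))\<^sup>2)"
proof (induction l rule: induct_nat_012)
  case 0
  then show ?case by (simp add: half_cosh_poly_def)
next
  have c: "cosh s = 1 + 2 * (sinh (s / 2))\<^sup>2"
    using cosh_double[of "s / 2"] by (simp add: cosh_square_eq)
  have step: "cosh (a + s) = (2 + 4 * (sinh (s / 2))\<^sup>2) * cosh a - cosh (a - s)" for a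
    by (simp add: cosh_add cosh_diff c algebra_simps)
  {
    case 1
    show ?case using step[of "s / 2"] by (simp add: half_cosh_poly_def algebra_simps)
  next
    case (ge2 n)
    have "(real (Suc (Suc n)) + 1 / 2) * s = (real (Suc n) + 1 / 2) * s + s"
         "(real (Suc n) + 1 / 2) * s - s = (real n + 1 / 2) * s" by (simp_all add: algebra_simps)
    then show ?case unfolding half_cosh_poly_Suc_Suc
      using step[of "(real (Suc n) + 1 / 2) * s"] ge2 by (simp only:) (simp add: algebra_simps)
  }
qed

text \<open>Expanding the hyperbolic cosine by \<open>cosh_half_odd\<close> leaves finitely many
  Gamma integrals with \<open>p = real k + 1 / 2\<close>, because x (cosh s - 1) = 2 x sinh(s / 2)^2
  and sinh s = 2 sinh(s / 2) cosh(s / 2).\<close>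

lemma bessel_K_real_has_integral:
  fixes x :: real
  assumes x: "x > 0"
  shows "((\<lambda>s. exp (- x * cosh s) * cosh ((real l + 1 / 2) * s)) has_integral
     exp (- x) * (\<Sum>k\<le>l. real (l + k choose (2 * k)) * 4 ^ k * (Gamma (real k + 1 / 2) / (2 * x) powr (real k + 1 / 2)))) {0..}"
proof -
  have 1: "((\<lambda>s. exp (- x * (cosh s - 1)) * cosh (s / 2) * (sinh (s / 2))\<^sup>2 ^ k) has_integral
      (Gamma (real k + 1 / 2) / (2 * x) powr (real k + 1 / 2))) {0<..}" for k
  proof -
    have "((\<lambda>s. (x * sinh s * ((x * (cosh s - 1)) powr (real k + 1 / 2 - 1) / exp (x * (cosh s - 1)))) / (2 * x) powr (real k + 1 / 2))
         has_integral (Gamma (real k + 1 / 2) / (2 * x) powr (real k + 1 / 2))) {0<..}"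
      by (intro has_integral_divide cosh_substitution_Gamma x) simp
    then show ?thesis
    proof (rule has_integral_eq[rotated])
      fix s :: real assume "s \<in> {0<..}"
      define w where "w = sinh (s / 2)"
      have w: "w > 0" using \<open>s \<in> _\<close> by (simp add: w_def)
      have c: "x * (cosh s - 1) = (2 * x) * w\<^sup>2"
        using cosh_double[of "s / 2"] by (simp add: cosh_square_eq w_def)
      have sh: "sinh s = 2 * w * cosh (s / 2)"
        using sinh_double[of "s / 2"] by (simp add: w_def)
      have "x * (2 * w) * ((2 * x) * w\<^sup>2) powr (real k + 1 / 2 - 1) = ((2 * x) * (2 * x) powr (real k + 1 / 2 - 1)) * (w * (w\<^sup>2) powr (real k + 1 / 2 - 1))"
        using x w by (simp add: powr_mult)
      also have "(2 * x) * (2 * x) powr (real k + 1 / 2 - 1) = (2 * x) powr (real k + 1 / 2)"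
        using x powr_mult_base[of "2 * x" "real k + 1 / 2 - 1"] by (simp add: add_ac)
      also have "w * (w\<^sup>2) powr (real k + 1 / 2 - 1) = (w\<^sup>2) ^ k"
      proof -
        have "(w\<^sup>2) powr (real k + 1 / 2 - 1) = w powr (real (2 * k) - 1)"
          using w powr_powr[of w 2 "real k + 1 / 2 - 1"] by (simp add: algebra_simps)
        then have "w * (w\<^sup>2) powr (real k + 1 / 2 - 1) = w powr real (2 * k)"
          using w powr_mult_base[of w "real (2 * k) - 1"] by simp
        then show ?thesis using w by (simp only: powr_realpow power_mult)
      qed
      finally have "x * (2 * w) * ((2 * x) * w\<^sup>2) powr (real k + 1 / 2 - 1) / (2 * x) powr (real k + 1 / 2) = (w\<^sup>2) ^ k"
        using x by simp
      then have "exp (- ((2 * x) * w\<^sup>2)) * cosh (s / 2) * (w\<^sup>2) ^ k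
         = exp (- ((2 * x) * w\<^sup>2)) * cosh (s / 2) * (x * (2 * w) * ((2 * x) * w\<^sup>2) powr (real k + 1 / 2 - 1) / (2 * x) powr (real k + 1 / 2))"
        by simp
      moreover have "exp (- x * (cosh s - 1)) = exp (- ((2 * x) * w\<^sup>2))" using c by simp
      ultimately show "(x * sinh s * ((x * (cosh s - 1)) powr (real k + 1 / 2 - 1) / exp (x * (cosh s - 1)))) / (2 * x) powr (real k + 1 / 2)
         = exp (- x * (cosh s - 1)) * cosh (s / 2) * (sinh (s / 2))\<^sup>2 ^ k"
        unfolding w_def[symmetric] sh c by (simp only: exp_minus) (simp add: field_simps)
    qed
  qed
  have "((\<lambda>s. exp (- x) * (\<Sum>k\<le>l. real (l + k choose (2 * k)) * 4 ^ k * (exp (- x * (cosh s - 1)) * cosh (s / 2) * (sinh (s / 2))\<^sup>2 ^ k)))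
      has_integral exp (- x) * (\<Sum>k\<le>l. real (l + k choose (2 * k)) * 4 ^ k * (Gamma (real k + 1 / 2) / (2 * x) powr (real k + 1 / 2)))) {0<..}"
    by (intro has_integral_mult_right has_integral_sum 1) auto
  moreover have "exp (- x) * (\<Sum>k\<le>l. real (l + k choose (2 * k)) * 4 ^ k * (exp (- x * (cosh s - 1)) * cosh (s / 2) * (sinh (s / 2))\<^sup>2 ^ k))
     = exp (- x * cosh s) * cosh ((real l + 1 / 2) * s)" for s
  proof -
    have "exp (- x * cosh s) = exp (- x) * exp (- x * (cosh s - 1))"
      by (simp add: algebra_simps flip: exp_add)
    then show ?thesis
      unfolding cosh_half_odd half_cosh_poly_def sum_distrib_left
      by (intro sum.cong refl) (simp add: power_mult_distrib)
  qed
  ultimately show ?thesis unfolding has_integral_Ici_iff_Ioi by (simp only:)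
qed

text \<open>The half-integer exponents cancel in the power of 2 and add to an integer in the power
  of \<open>x\<close>, so the normalized K is elementary.\<close>

lemma half_power_powr_quotient:
  fixes x :: real
  assumes x: "x > 0" and kl: "k \<le> l"
  shows "(x / 2) powr - (real l + 1 / 2) / (2 * x) powr (real k + 1 / 2) = 2 ^ (l - k) / x ^ (l + k + 1)"
proof -
  have "(x / 2) powr - (real l + 1 / 2) / (2 * x) powr (real k + 1 / 2)
      = (2 powr (real l + 1 / 2) / 2 powr (real k + 1 / 2)) / (x powr (real l + 1 / 2) * x powr (real k + 1 / 2))"
    using x by (simp only: powr_minus powr_divide powr_mult) (simp add: field_simps)
  also have "2 powr (real l + 1 / 2) / 2 powr (real k + 1 / 2) = (2::real) powr real (l - k)"
    using kl by (simp add: of_nat_diff flip: powr_diff)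
  also have "x powr (real l + 1 / 2) * x powr (real k + 1 / 2) = x powr real (l + k + 1)"
    by (simp add: add_ac flip: powr_add)
  finally show ?thesis using x by (simp only: powr_realpow)
qed

text \<open>Trades the coefficients of the cosh expansion for those appearing in
  \<open>hyp_moment\<close>.\<close>

lemma choose_fact_identity:
  assumes "k \<le> l"
  shows "real (l + k choose (2 * k)) * fact (2 * k) / fact k = real (l choose k) * fact (l + k) / fact l"
proof -
  have "real (l + k choose (2 * k)) = fact (l + k) / (fact (2 * k) * fact (l - k))"
    using assms by (subst binomial_fact) (auto simp: mult_2)
  moreover have "real (l choose k) = fact l / (fact k * fact (l - k))"
    using assms by (rule binomial_fact)
  ultimately show ?thesis by simp
qed

lemma cosh_complex_of_real: "cosh (complex_of_real s) = of_real (cosh s)"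
  by (simp add: cosh_def scaleR_conv_of_real flip: exp_of_real)

lemma bessel_K_integrand_of_real:
  "exp (- complex_of_real x * cosh (of_real s)) * cosh ((of_nat l + 1 / 2) * of_real s)
     = of_real (exp (- x * cosh s) * cosh ((real l + 1 / 2) * s))"
  unfolding of_real_mult exp_of_real[symmetric] cosh_complex_of_real[symmetric] by simp

lemma bessel_K_tilde_of_real:
  fixes x :: real
  assumes x: "x > 0"
  shows "bessel_K_tilde (of_nat l + 1 / 2) (of_real x) = of_real (sqrt pi / fact l * exp (- x)
           * (\<Sum>k\<le>l. real (l choose k) * 2 ^ (l - k) * fact (l + k) / x ^ (l + k + 1)))"
proof -
  have "bessel_K (of_nat l + 1 / 2) (of_real x) = of_real (exp (- x) * (\<Sum>k\<le>l. real (l + k choose (2 * k)) * 4 ^ k *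
     (Gamma (real k + 1 / 2) / (2 * x) powr (real k + 1 / 2))))"
    unfolding bessel_K_def bessel_K_integrand_of_real
    by (intro integral_unique has_integral_of_real bessel_K_real_has_integral x)
  moreover have "(of_real x / 2) powr - (of_nat l + 1 / 2) = complex_of_real ((x / 2) powr - (real l + 1 / 2))"
    using x by (subst powr_of_real[symmetric]) auto
  ultimately have "bessel_K_tilde (of_nat l + 1 / 2) (of_real x) = of_real ((x / 2) powr - (real l + 1 / 2) *
      (exp (- x) * (\<Sum>k\<le>l. real (l + k choose (2 * k)) * 4 ^ k * (Gamma (real k + 1 / 2) / (2 * x) powr (real k + 1 / 2)))))"
    unfolding bessel_K_tilde_def by (simp only: of_real_mult)
  also have "(x / 2) powr - (real l + 1 / 2) *
      (exp (- x) * (\<Sum>k\<le>l. real (l + k choose (2 * k)) * 4 ^ k * (Gamma (real k + 1 / 2) / (2 * x) powr (real k + 1 / 2))))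
    = sqrt pi / fact l * exp (- x) * (\<Sum>k\<le>l. real (l choose k) * 2 ^ (l - k) * fact (l + k) / x ^ (l + k + 1))"
    unfolding sum_distrib_left
  proof (intro sum.cong refl)
    fix k assume "k \<in> {..l}"
    then have k: "k \<le> l" by simp
    have "(x / 2) powr - (real l + 1 / 2) * (exp (- x) * (real (l + k choose (2 * k)) * 4 ^ k * (Gamma (real k + 1 / 2) / (2 * x) powr (real k + 1 / 2))))
       = exp (- x) * sqrt pi * (real (l + k choose (2 * k)) * fact (2 * k) / fact k) * ((x / 2) powr - (real l + 1 / 2) / (2 * x) powr (real k + 1 / 2))"
      unfolding Gamma_half_plus_nat by simp
    then show "(x / 2) powr - (real l + 1 / 2) * (exp (- x) * (real (l + k choose (2 * k)) * 4 ^ k * (Gamma (real k + 1 / 2) / (2 * x) powr (real k + 1 / 2))))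
       = sqrt pi / fact l * exp (- x) * (real (l choose k) * 2 ^ (l - k) * fact (l + k) / x ^ (l + k + 1))"
      unfolding half_power_powr_quotient[OF x k] choose_fact_identity[OF k] by simp
  qed
  finally show ?thesis .
qed

lemma bessel_K_holomorphic: "bessel_K (of_nat l + 1 / 2) holomorphic_on {z. Re z > 0}"
  unfolding bessel_K_def
proof (rule holomorphic_improper_integral(2)[where a = "\<lambda>_. 0" and b = real
      and f' = "\<lambda>z s. exp (- z * cosh (of_real s)) * (- cosh (of_real s)) * cosh ((of_nat l + 1 / 2) * of_real s)"])
  show "convex {z. Re z > 0}" "open {z. Re z > 0}"
    by (auto simp: convex_halfspace_Re_gt open_halfspace_Re_gt)
  show "incseq (\<lambda>n. {0..real n})" by (auto simp: incseq_def)
  show "{0..} = (\<Union>n. {0..real n})" using real_arch_simple by fastforce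
  show "((\<lambda>z. exp (- z * cosh (of_real s)) * cosh ((of_nat l + 1 / 2) * of_real s)) has_field_derivative
     exp (- z * cosh (of_real s)) * (- cosh (of_real s)) * cosh ((of_nat l + 1 / 2) * of_real s)) (at z)" for z s
    by (auto intro!: derivative_eq_intros)
  show "continuous_on {0..} (\<lambda>s. exp (- z * cosh (complex_of_real s)) * cosh ((of_nat l + 1 / 2) * of_real s))" for z
    by (intro continuous_intros)
  show "continuous_on ({z. Re z > 0} \<times> {0..})
     (\<lambda>(z, s). exp (- z * cosh (complex_of_real s)) * (- cosh (of_real s)) * cosh ((of_nat l + 1 / 2) * of_real s))"
    unfolding case_prod_unfold by (intro continuous_intros)
  fix z assume "z \<in> {z. Re z > 0}"
  then have z: "Re z > 0" by simp
  show "\<exists>d>0. \<exists>h. cball z d \<subseteq> {z. Re z > 0} \<and> h integrable_on {0..} \<and>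
     (\<forall>w\<in>cball z d. \<forall>s\<in>{0..}. norm (exp (- w * cosh (of_real s)) * cosh ((of_nat l + 1 / 2) * of_real s)) \<le> h s)"
  proof (intro exI conjI ballI)
    \<comment> \<open>On the disc of radius \<open>Re z / 2\<close> the real part stays at least
      \<open>Re z / 2\<close>, so the real integrand at that point is a majorant, integrable by
      \<open>bessel_K_real_has_integral\<close>.\<close>
    show "Re z / 2 > 0" using z by simp
    have Re: "Re w \<ge> Re z / 2" if "w \<in> cball z (Re z / 2)" for w
      using that abs_Re_le_cmod[of "z - w"] by (auto simp: dist_norm)
    show "cball z (Re z / 2) \<subseteq> {z. Re z > 0}" using Re z by fastforce
    show "(\<lambda>s. exp (- (Re z / 2) * cosh s) * cosh ((real l + 1 / 2) * s)) integrable_on {0..}"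
      by (rule has_integral_integrable[OF bessel_K_real_has_integral]) (use z in simp)
    fix w s assume w: "w \<in> cball z (Re z / 2)"
    have c: "cosh ((of_nat l + 1 / 2) * complex_of_real s) = of_real (cosh ((real l + 1 / 2) * s))"
      using cosh_complex_of_real[of "(real l + 1 / 2) * s"] by simp
    have "norm (exp (- w * cosh (of_real s)) * cosh ((of_nat l + 1 / 2) * of_real s)) = exp (- Re w * cosh s) * cosh ((real l + 1 / 2) * s)"
      unfolding c cosh_complex_of_real norm_mult by simp
    also have "\<dots> \<le> exp (- (Re z / 2) * cosh s) * cosh ((real l + 1 / 2) * s)"
      using Re[OF w] by (intro mult_right_mono iffD2[OF exp_le_cancel_iff]) auto
    finally show "norm (exp (- w * cosh (of_real s)) * cosh ((of_nat l + 1 / 2) * of_real s)) \<le> exp (- (Re z / 2) * cosh s) * cosh ((real l + 1 / 2) * s)" .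
  qed
qed

text \<open>Continuation from the positive axis to the half plane; complex arguments arise because K
  is needed at x (1 - s) for complex s near 0.\<close>

lemma bessel_K_tilde_half_integer:
  assumes z: "Re z > 0"
  shows "bessel_K_tilde (of_nat l + 1 / 2) z = of_real (sqrt pi) / fact l * exp (- z)
           * (\<Sum>k\<le>l. of_nat (l choose k) * 2 ^ (l - k) * fact (l + k) / z ^ (l + k + 1))"
proof (rule holomorphic_eq_from_reals[where S = "{z. Re z > 0}" and a = 1 and z = z])
  show "bessel_K_tilde (of_nat l + 1 / 2) holomorphic_on {z. Re z > 0}"
    unfolding bessel_K_tilde_def[abs_def]
    by (intro holomorphic_intros bessel_K_holomorphic) (auto simp: complex_nonpos_Reals_iff)
  show "(\<lambda>z. of_real (sqrt pi) / fact l * exp (- z)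
           * (\<Sum>k\<le>l. of_nat (l choose k) * 2 ^ (l - k) * fact (l + k) / z ^ (l + k + 1))) holomorphic_on {z. Re z > 0}"
    by (intro holomorphic_intros) auto
  fix x assume "complex_of_real x \<in> {z. Re z > 0}"
  then show "bessel_K_tilde (of_nat l + 1 / 2) (of_real x) = of_real (sqrt pi) / fact l * exp (- of_real x)
           * (\<Sum>k\<le>l. of_nat (l choose k) * 2 ^ (l - k) * fact (l + k) / of_real x ^ (l + k + 1))"
    by (subst bessel_K_tilde_of_real) (auto simp flip: exp_of_real)
qed (use z in \<open>auto simp: open_halfspace_Re_gt convex_halfspace_Re_gt convex_connected\<close>)

section \<open>The generating function\<close>

text \<open>\<open>S ^ i\<close> has no terms below degree \<open>i\<close>, so one cutoff
  \<open>i \<le> j\<close> serves every coefficient involved and the two finite sums can be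
  exchanged.\<close>

lemma fps_mult_compose_nth:
  fixes P H S :: "complex fps"
  assumes S: "fps_nth S 0 = 0"
  shows "fps_nth (P * fps_compose H S) j = (\<Sum>i\<le>j. fps_nth H i * fps_nth (P * S ^ i) j)"
proof -
  have H: "fps_nth (fps_compose H S) n = (\<Sum>i\<le>j. fps_nth H i * fps_nth (S ^ i) n)" if "n \<le> j" for n
    unfolding fps_compose_nth using that S
    by (intro sum.mono_neutral_left) (auto simp: startsby_zero_power_prefix not_le)
  have "fps_nth (P * fps_compose H S) j = (\<Sum>n=0..j. fps_nth P n * (\<Sum>i\<le>j. fps_nth H i * fps_nth (S ^ i) (j - n)))"
    unfolding fps_mult_nth by (intro sum.cong refl) (simp add: H)
  also have "\<dots> = (\<Sum>i\<le>j. fps_nth H i * (\<Sum>n=0..j. fps_nth P n * fps_nth (S ^ i) (j - n)))"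
    unfolding sum_distrib_left by (subst sum.swap) (simp add: mult_ac)
  finally show ?thesis unfolding fps_mult_nth .
qed

text \<open>The power \<open>i\<close> of - t / (1 - t) times (1 - t)^(- \<alpha> - 1) is (-t)^i (1
  - t)^(- \<alpha> - 1 - i), a binomial series. For \<open>H = fps_exp y\<close> this is the
  Laguerre generating function; a general \<open>H\<close> lets moments replace the powers of
  \<open>y\<close>.\<close>

lemma laguerre_generating_coeff:
  fixes \<alpha> :: complex and H :: "complex fps"
  defines "Y \<equiv> fps_const (-1) * fps_X"
  shows "fps_nth (fps_compose (fps_binomial (- \<alpha> - 1)) Y * fps_compose H (Y * inverse (1 - fps_X))) j
       = (\<Sum>i\<le>j. (-1) ^ i * ((of_nat j + \<alpha>) gchoose (j - i)) * fps_nth H i)"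
proof -
  have inv: "inverse (1 - fps_X) = fps_compose (fps_binomial (- 1)) Y"
  proof -
    have "Y = - fps_X" unfolding Y_def fps_const_neg[symmetric] by simp
    then show ?thesis using one_minus_fps_X_const_neg_power[of "1 :: complex" 1] by simp
  qed
  have Y0: "fps_nth Y 0 = 0" by (simp add: Y_def)
  have "fps_nth (fps_compose (fps_binomial (- \<alpha> - 1)) Y * (Y * inverse (1 - fps_X)) ^ i) j
      = (-1) ^ i * ((of_nat j + \<alpha>) gchoose (j - i))" if i: "i \<le> j" for i
  proof -
    have "fps_compose (fps_binomial (- \<alpha> - 1)) Y * (Y * inverse (1 - fps_X)) ^ i
       = Y ^ i * fps_compose (fps_binomial (- \<alpha> - 1) * fps_binomial (- 1) ^ i) Y"
      unfolding inv power_mult_distrib fps_compose_mult_distrib[OF Y0] fps_compose_power[OF Y0] by (simp add: mult_ac)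
    also have "fps_binomial (- \<alpha> - 1) * fps_binomial (- 1) ^ i = fps_binomial (- \<alpha> - 1 - of_nat i)"
      by (simp add: fps_binomial_power flip: fps_binomial_add_mult)
    also have "Y ^ i = fps_const ((-1) ^ i) * fps_X ^ i"
      unfolding Y_def power_mult_distrib fps_const_power ..
    finally have "fps_nth (fps_compose (fps_binomial (- \<alpha> - 1)) Y * (Y * inverse (1 - fps_X)) ^ i) j
       = (-1) ^ i * ((-1) ^ (j - i) * ((- \<alpha> - 1 - of_nat i) gchoose (j - i)))"
      using i unfolding mult.assoc by (simp add: fps_X_power_mult_nth Y_def fps_compose_linear)
    also have "(-1) ^ (j - i) * ((- \<alpha> - 1 - of_nat i) gchoose (j - i)) = (of_nat j + \<alpha>) gchoose (j - i)"
      using i by (subst gbinomial_negated_upper) (simp add: of_nat_diff algebra_simps flip: power_mult_distrib mult.assoc)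
    finally show ?thesis .
  qed
  moreover have "fps_nth (Y * inverse (1 - fps_X)) 0 = 0" by (simp add: Y0)
  ultimately show ?thesis by (subst fps_mult_compose_nth) (auto intro!: sum.cong)
qed

lemma bessel_I_tilde_expansion:
  assumes \<mu>: "Re \<mu> > -1"
  shows "(\<lambda>s. of_real (sqrt pi) * Gamma ((\<mu> + 1) / 2) * bessel_I_tilde (\<mu> / 2) (c * s))
            has_fps_expansion Abs_fps (\<lambda>a. sin_int \<mu> (monom 1 a) / fact a * c ^ a)"
  using bessel_I_tilde_sums[OF \<mu>, of "c * s" for s]
  by (intro has_fps_expansionI always_eventually) (simp add: power_mult_distrib mult_ac)

text \<open>By the closed form, the function is a combination of exp(x s) (1 - s)^(-(l + k + 1)).
  Convolving the exponential series with the negative binomial series gives the inner sum of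
  \<open>hyp_moment\<close>, divided by \<open>fact b\<close>.\<close>

lemma bessel_K_tilde_expansion:
  assumes x: "x > 0"
  shows "(\<lambda>s. of_real (x ^ (2 * l + 1) * exp x) * (fact l / of_real (sqrt pi)) * bessel_K_tilde (of_nat l + 1 / 2) (of_real x * (1 - s)))
            has_fps_expansion Abs_fps (\<lambda>b. of_real (hyp_moment x l b) / fact b)"
    (is "?f has_fps_expansion ?F")
proof -
  \<comment> \<open>The prefactor x^(2l + 1) against x^(l + k + 1) in the denominator leaves x^(l -
    k), which joins the power of 2.\<close>
  define c where "c k = complex_of_real (real (l choose k) * (2 * x) ^ (l - k) * fact (l + k))" for k
  have "(\<lambda>s. \<Sum>k\<le>l. c k * (exp (of_real x * s) * inverse ((1 - s) ^ (l + k + 1)))) has_fps_expansion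
      (\<Sum>k\<le>l. fps_const (c k) * (fps_exp (of_real x) * inverse ((1 - fps_X) ^ (l + k + 1))))"
    by (intro fps_expansion_intros) auto
  also have "(\<Sum>k\<le>l. fps_const (c k) * (fps_exp (of_real x) * inverse ((1 - fps_X) ^ (l + k + 1)))) = ?F"
  proof (rule fps_ext)
    fix b
    have "fps_nth (fps_const (c k) * (fps_exp (of_real x) * inverse ((1 - fps_X) ^ (l + k + 1)))) b
       = of_real (\<Sum>i\<le>b. real (l choose k) * (2 * x) ^ (l - k) * (real (b choose i) * x ^ (b - i)) * fact (l + k + i)) / fact b" for k
    proof -
      have inv: "inverse ((1 - fps_X) ^ (l + k + 1)) = Abs_fps (\<lambda>i. of_nat (l + k + i choose i) :: complex)"
        using one_minus_const_fps_X_neg_power'[of "l + k + 1" "1 :: complex"] by simp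
      have 1: "fps_nth (fps_exp (of_real x) * inverse ((1 - fps_X) ^ (l + k + 1))) b
         = (\<Sum>i\<le>b. complex_of_real (x ^ (b - i) / fact (b - i) * real (l + k + i choose i)))"
        unfolding inv mult.commute[of "fps_exp (complex_of_real x)"] fps_mult_nth atLeast0AtMost
        by (intro sum.cong refl) simp
      have 2: "real (l choose k) * (2 * x) ^ (l - k) * fact (l + k) * (x ^ (b - i) / fact (b - i) * real (l + k + i choose i))
          = real (l choose k) * (2 * x) ^ (l - k) * (real (b choose i) * x ^ (b - i)) * fact (l + k + i) / fact b" if "i \<le> b" for i
      proof -
        have "real (b choose i) = fact b / (fact i * fact (b - i))"
          using that by (rule binomial_fact)
        moreover have "real (l + k + i choose i) = fact (l + k + i) / (fact i * fact (l + k))"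
          by (subst binomial_fact) auto
        ultimately show ?thesis by simp
      qed
      have "fps_nth (fps_const (c k) * (fps_exp (of_real x) * inverse ((1 - fps_X) ^ (l + k + 1)))) b
         = of_real (\<Sum>i\<le>b. real (l choose k) * (2 * x) ^ (l - k) * fact (l + k) * (x ^ (b - i) / fact (b - i) * real (l + k + i choose i)))"
        unfolding fps_mult_left_const_nth 1 c_def by (simp only: of_real_sum of_real_mult sum_distrib_left)
      also have "(\<Sum>i\<le>b. real (l choose k) * (2 * x) ^ (l - k) * fact (l + k) * (x ^ (b - i) / fact (b - i) * real (l + k + i choose i)))
         = (\<Sum>i\<le>b. real (l choose k) * (2 * x) ^ (l - k) * (real (b choose i) * x ^ (b - i)) * fact (l + k + i)) / fact b"
        unfolding sum_divide_distrib by (intro sum.cong refl 2) simp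
      finally show ?thesis by (simp only: of_real_divide of_real_fact)
    qed
    then show "fps_nth (\<Sum>k\<le>l. fps_const (c k) * (fps_exp (of_real x) * inverse ((1 - fps_X) ^ (l + k + 1)))) b = fps_nth ?F b"
      by (simp only: fps_sum_nth fps_nth_Abs_fps hyp_moment_def of_real_sum sum_divide_distrib)
  qed
  finally show ?thesis
  proof (rule has_fps_expansion_cong[THEN iffD1, rotated 2])
    \<comment> \<open>Agreement near 0 is all that an expansion needs; on the unit disc
      \<open>1 - s\<close> has positive real part, so the closed form for K is available.\<close>
    show "\<forall>\<^sub>F s in nhds 0. (\<Sum>k\<le>l. c k * (exp (of_real x * s) * inverse ((1 - s) ^ (l + k + 1)))) = ?f s"
    proof (rule eventually_mono[OF eventually_nhds_in_open[of "ball 0 1"]])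
      fix s :: complex assume "s \<in> ball 0 1"
      then have "Re s < 1" using complex_Re_le_cmod[of s] by simp
      then have Re: "Re (of_real x * (1 - s)) > 0" and s1: "1 - s \<noteq> 0" using x by auto
      have e: "exp (- (of_real x * (1 - s))) = exp (- of_real x) * exp (of_real x * s)"
        by (simp add: algebra_simps flip: exp_add)
      have ex: "complex_of_real (exp x) * exp (- of_real x) = 1"
        by (simp add: exp_minus flip: exp_of_real)
      have "?f s = (\<Sum>k\<le>l. of_real (x ^ (2 * l + 1)) * (complex_of_real (exp x) * exp (- of_real x)) * exp (of_real x * s) *
           (of_nat (l choose k) * 2 ^ (l - k) * fact (l + k) / (of_real x * (1 - s)) ^ (l + k + 1)))"
        unfolding bessel_K_tilde_half_integer[OF Re] e sum_distrib_left by (intro sum.cong refl) simp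
      also have "\<dots> = (\<Sum>k\<le>l. c k * (exp (of_real x * s) * inverse ((1 - s) ^ (l + k + 1))))"
      proof (intro sum.cong refl)
        fix k assume "k \<in> {..l}"
        then have xp: "complex_of_real (x ^ (2 * l + 1)) = of_real x ^ (l - k) * of_real x ^ (l + k + 1)"
          unfolding of_real_power by (simp add: mult_2 flip: power_add)
        show "of_real (x ^ (2 * l + 1)) * (complex_of_real (exp x) * exp (- of_real x)) * exp (of_real x * s) *
           (of_nat (l choose k) * 2 ^ (l - k) * fact (l + k) / (of_real x * (1 - s)) ^ (l + k + 1))
           = c k * (exp (of_real x * s) * inverse ((1 - s) ^ (l + k + 1)))"
          unfolding ex xp power_mult_distrib[of "of_real x"] using x s1 by (simp add: c_def power_mult_distrib divide_simps)
      qed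
      finally show "(\<Sum>k\<le>l. c k * (exp (of_real x * s) * inverse ((1 - s) ^ (l + k + 1)))) = ?f s" ..
    qed auto
  qed simp
qed

section \<open>Derivatives of the generating function and the double integral as one finite
  sum\<close>

text \<open>The coefficient of s^k in the product of the I and K expansions. By the binomial theorem
  it is also 1 / k! times the double integral of (x (cos \<psi> + cosh \<phi>))^k against the
  weight, including the factor x^(2l + 1).\<close>

definition laguerre_moment :: "complex \<Rightarrow> nat \<Rightarrow> nat \<Rightarrow> real \<Rightarrow> complex" where
  "laguerre_moment \<mu> l k x =
     (\<Sum>a\<le>k. sin_int \<mu> (monom 1 a) / fact a * of_real x ^ a * (of_real (hyp_moment x l (k - a)) / fact (k - a)))"

text \<open>For s = - t / (1 - t) and argument 2 x, the Bessel arguments in \<open>G_fun\<close> are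
  - x s and x (1 - s), and the power of 1 - t has exponent - \<alpha> - 1 with \<alpha> as in the
  Laguerre polynomial. \<open>laguerre_generating_coeff\<close> then gives the Taylor coefficients
  in t.\<close>

lemma deriv_G_fun:
  assumes \<mu>: "Re \<mu> > -1" and x: "x > 0"
  shows "fact l * Gamma ((\<mu> + 1) / 2) * (deriv ^^ j) (\<lambda>t. G_fun \<mu> l t (2 * x)) 0
       = fact j * (\<Sum>k\<le>j. (-1) ^ k * ((of_nat j + (of_nat l + (\<mu> + 1) / 2)) gchoose (j - k)) * laguerre_moment \<mu> l k x)"
proof -
  define \<alpha> where "\<alpha> = of_nat l + (\<mu> + 1) / 2"
  define Y where "Y = fps_const (-1 :: complex) * fps_X"
  \<comment> \<open>What remains of the normalizations of \<open>I\<close> and \<open>N\<close> once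
    their factors \<open>sqrt pi\<close> cancel.\<close>
  define K where "K = fact l * Gamma ((\<mu> + 1) / 2)"
  define I where "I s = of_real (sqrt pi) * Gamma ((\<mu> + 1) / 2) * bessel_I_tilde (\<mu> / 2) (of_real x * s)" for s
  define N where "N s = of_real (x ^ (2 * l + 1) * exp x) * (fact l / of_real (sqrt pi))
      * bessel_K_tilde (of_nat l + 1 / 2) (of_real x * (1 - s))" for s
  define H where "H = Abs_fps (\<lambda>a. sin_int \<mu> (monom 1 a) / fact a * of_real x ^ a)
      * Abs_fps (\<lambda>b. complex_of_real (hyp_moment x l b) / fact b)"
  have H: "(\<lambda>s. I s * N s) has_fps_expansion H"
    unfolding I_def N_def H_def by (intro has_fps_expansion_mult bessel_I_tilde_expansion bessel_K_tilde_expansion \<mu> x)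
  have Y: "(\<lambda>t. -1 * t) has_fps_expansion Y" unfolding Y_def by (intro fps_expansion_intros)
  have S: "(\<lambda>t. -1 * t * inverse (1 - t)) has_fps_expansion Y * inverse (1 - fps_X)"
    by (intro has_fps_expansion_mult[OF Y] fps_expansion_intros) auto
  have "(\<lambda>t. ((\<lambda>z. (1 + z) powr (- \<alpha> - 1)) \<circ> (\<lambda>t. -1 * t)) t * ((\<lambda>s. I s * N s) \<circ> (\<lambda>t. -1 * t * inverse (1 - t))) t)
      has_fps_expansion fps_compose (fps_binomial (- \<alpha> - 1)) Y * fps_compose H (Y * inverse (1 - fps_X))"
    by (intro has_fps_expansion_mult has_fps_expansion_compose has_fps_expansion_binomial_complex Y H S)
       (simp_all add: Y_def)
  moreover have "\<forall>\<^sub>F t in nhds 0. ((\<lambda>z. (1 + z) powr (- \<alpha> - 1)) \<circ> (\<lambda>t. -1 * t)) t * ((\<lambda>s. I s * N s) \<circ> (\<lambda>t. -1 * t * inverse (1 - t))) t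
      = K * G_fun \<mu> l t (2 * x)"
  proof (rule eventually_mono[OF eventually_nhds_in_open[of "ball 0 1"]])
    fix t :: complex assume "t \<in> ball 0 1"
    then have t: "1 - t \<noteq> 0" by auto
    have p: "(1 - t) powr (- \<alpha> - 1) = 1 / (1 - t) powr (of_nat l + (\<mu> + 3) / 2)"
    proof -
      have "- \<alpha> - 1 = - (of_nat l + (\<mu> + 3) / 2)" by (simp add: \<alpha>_def field_simps)
      then show ?thesis by (simp only: powr_minus_divide)
    qed
    have "y * (-1 * t * inverse u) = - (t * (of_real 2 * y) / (2 * u))" for y u :: complex
      by (cases "u = 0") (simp_all add: field_simps)
    then have "of_real x * (-1 * t * inverse (1 - t)) = - (t * of_real (2 * x) / (2 * (1 - t)))"
      unfolding of_real_mult .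
    then have I: "I (-1 * t * inverse (1 - t)) = of_real (sqrt pi) * Gamma ((\<mu> + 1) / 2) * bessel_I_tilde (\<mu> / 2) (t * of_real (2 * x) / (2 * (1 - t)))"
      unfolding I_def by (simp only: bessel_I_tilde_minus)
    have "of_real x * (1 - (-1 * t * inverse (1 - t))) = of_real (2 * x) / (2 * (1 - t))"
      using t by (simp add: field_simps)
    then have N: "N (-1 * t * inverse (1 - t)) = of_real (x ^ (2 * l + 1) * exp x) * (fact l / of_real (sqrt pi))
        * bessel_K_tilde (of_nat l + 1 / 2) (of_real (2 * x) / (2 * (1 - t)))"
      unfolding N_def by (simp only:)
    have x2: "2 * x / 2 = x" by simp
    have p': "(1 + -1 * t) powr (- \<alpha> - 1) = 1 / (1 - t) powr (of_nat l + (\<mu> + 3) / 2)" using p by simp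
    have sq: "complex_of_real (sqrt pi) \<noteq> 0" by simp
    show "((\<lambda>z. (1 + z) powr (- \<alpha> - 1)) \<circ> (\<lambda>t. -1 * t)) t * ((\<lambda>s. I s * N s) \<circ> (\<lambda>t. -1 * t * inverse (1 - t))) t
      = K * G_fun \<mu> l t (2 * x)"
      unfolding o_def I N p' K_def G_fun_def x2 of_real_mult[of "x ^ (2 * l + 1)"] using sq by simp
  qed auto
  ultimately have "(\<lambda>t. K * G_fun \<mu> l t (2 * x)) has_fps_expansion
      fps_compose (fps_binomial (- \<alpha> - 1)) Y * fps_compose H (Y * inverse (1 - fps_X))"
    by (simp only: has_fps_expansion_cong)
  moreover have K: "K \<noteq> 0" unfolding K_def
    using \<mu> Re_pos_not_nonpos_Int[of "(\<mu> + 1) / 2"] by (simp add: Gamma_eq_zero_iff)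
  ultimately have "(\<lambda>t. inverse K * (K * G_fun \<mu> l t (2 * x))) has_fps_expansion
      fps_const (inverse K) * (fps_compose (fps_binomial (- \<alpha> - 1)) Y * fps_compose H (Y * inverse (1 - fps_X)))"
    by (intro has_fps_expansion_cmult_left)
  then have "(\<lambda>t. G_fun \<mu> l t (2 * x)) has_fps_expansion
      fps_const (inverse K) * (fps_compose (fps_binomial (- \<alpha> - 1)) Y * fps_compose H (Y * inverse (1 - fps_X)))"
    using K by (simp only: mult.assoc[symmetric] left_inverse mult_1_left not_False_eq_True)
  from fps_nth_fps_expansion[OF this, of j]
  have "K * (deriv ^^ j) (\<lambda>t. G_fun \<mu> l t (2 * x)) 0
     = fact j * fps_nth (fps_compose (fps_binomial (- \<alpha> - 1)) Y * fps_compose H (Y * inverse (1 - fps_X))) j"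
    unfolding fps_mult_left_const_nth using K by (simp add: field_simps)
  also have "fps_nth (fps_compose (fps_binomial (- \<alpha> - 1)) Y * fps_compose H (Y * inverse (1 - fps_X))) j
     = (\<Sum>k\<le>j. (-1) ^ k * ((of_nat j + \<alpha>) gchoose (j - k)) * laguerre_moment \<mu> l k x)"
    unfolding Y_def laguerre_generating_coeff
    by (intro sum.cong refl) (simp add: H_def fps_mult_nth atLeast0AtMost laguerre_moment_def)
  finally show ?thesis unfolding K_def \<alpha>_def .
qed

text \<open>The Laguerre polynomial and the powers of the sum are finite expansions, so both
  iterated integrals are evaluated term by term as moments; no exchange of integrals is
  needed.\<close>

lemma double_integral_eq:
  assumes \<mu>: "Re \<mu> > -1" and x: "x > 0"
  shows "of_real (x ^ (2 * l + 1)) *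
      integral {0..pi} (\<lambda>\<psi>::real. integral {0..} (\<lambda>\<phi>::real.
        of_real (exp (- x * (cosh \<phi> - 1)))
        * laguerre j \<alpha> (of_real (x * (cos \<psi> + cosh \<phi>)))
        * of_real (sin \<psi>) powr \<mu> * of_real (sinh \<phi> ^ (2 * l + 1))))
     = (\<Sum>k\<le>j. (-1) ^ k * ((of_nat j + \<alpha>) gchoose (j - k)) * laguerre_moment \<mu> l k x)"
proof -
  let ?X = "complex_of_real (x ^ (2 * l + 1))"
  \<comment> \<open>The coefficient of cos(\<psi>)^a (x cosh \<phi>)^(k - a). The powers of
    \<open>x\<close> attached to the hyperbolic cosine stay inside \<open>hyp_moment\<close>, which
    also contains the factor \<open>?X\<close>; hence the division by \<open>?X\<close> in the inner
    integral.\<close>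
  define c where "c k a = (-1) ^ k / fact k * ((of_nat j + \<alpha>) gchoose (j - k)) * of_nat (k choose a) * of_real x ^ a" for k a
  have X: "?X \<noteq> 0" using x by simp
  have inner: "integral {0..} (\<lambda>\<phi>::real.
        of_real (exp (- x * (cosh \<phi> - 1)))
        * laguerre j \<alpha> (of_real (x * (cos \<psi> + cosh \<phi>)))
        * of_real (sin \<psi>) powr \<mu> * of_real (sinh \<phi> ^ (2 * l + 1)))
     = (\<Sum>k\<le>j. \<Sum>a\<le>k. c k a * of_real (hyp_moment x l (k - a)) / ?X * (poly (monom 1 a) (of_real (cos \<psi>)) * of_real (sin \<psi>) powr \<mu>))" (is "integral _ ?f = ?r") for \<psi> :: real
  proof (rule integral_unique)
    have 1: "((\<lambda>\<phi>. complex_of_real (x ^ (2 * l + 1) * (exp (- x * (cosh \<phi> - 1)) * (x * cosh \<phi>) ^ b * sinh \<phi> ^ (2 * l + 1))))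
        has_integral of_real (hyp_moment x l b)) {0..}" for b
      by (intro has_integral_of_real hyp_moment_has_integral x)
    have "((\<lambda>\<phi>. \<Sum>k\<le>j. \<Sum>a\<le>k. (c k a / ?X * (poly (monom 1 a) (of_real (cos \<psi>)) * of_real (sin \<psi>) powr \<mu>)) *
          complex_of_real (x ^ (2 * l + 1) * (exp (- x * (cosh \<phi> - 1)) * (x * cosh \<phi>) ^ (k - a) * sinh \<phi> ^ (2 * l + 1))))
        has_integral (\<Sum>k\<le>j. \<Sum>a\<le>k. (c k a / ?X * (poly (monom 1 a) (of_real (cos \<psi>)) * of_real (sin \<psi>) powr \<mu>)) * of_real (hyp_moment x l (k - a)))) {0..}"
      by (intro has_integral_sum has_integral_mult_right 1) auto
    moreover have "(\<Sum>k\<le>j. \<Sum>a\<le>k. (c k a / ?X * (poly (monom 1 a) (of_real (cos \<psi>)) * of_real (sin \<psi>) powr \<mu>)) *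
          complex_of_real (x ^ (2 * l + 1) * (exp (- x * (cosh \<phi> - 1)) * (x * cosh \<phi>) ^ (k - a) * sinh \<phi> ^ (2 * l + 1))))
        = ?f \<phi>" for \<phi>
    proof -
      have "laguerre j \<alpha> (of_real (x * (cos \<psi> + cosh \<phi>)))
        = (\<Sum>k\<le>j. \<Sum>a\<le>k. c k a * of_real (cos \<psi>) ^ a * of_real (x * cosh \<phi>) ^ (k - a))"
      proof -
        have "complex_of_real (x * (cos \<psi> + cosh \<phi>)) = of_real (x * cos \<psi>) + of_real (x * cosh \<phi>)"
          by (simp add: algebra_simps)
        then show ?thesis
          unfolding laguerre_def atLeast0AtMost
          by (simp only: binomial_ring sum_distrib_left) (intro sum.cong refl, simp add: c_def power_mult_distrib)
      qed
      then have f: "?f \<phi> = of_real (exp (- x * (cosh \<phi> - 1))) * of_real (sin \<psi>) powr \<mu> * of_real (sinh \<phi> ^ (2 * l + 1)) *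
          (\<Sum>k\<le>j. \<Sum>a\<le>k. c k a * of_real (cos \<psi>) ^ a * of_real (x * cosh \<phi>) ^ (k - a))"
        by (simp only: mult_ac)
      show ?thesis
        unfolding f sum_distrib_left
      proof (intro sum.cong refl)
        fix k a :: nat
        have "complex_of_real (x ^ (2 * l + 1) * (exp (- x * (cosh \<phi> - 1)) * (x * cosh \<phi>) ^ (k - a) * sinh \<phi> ^ (2 * l + 1)))
           = ?X * (of_real (exp (- x * (cosh \<phi> - 1))) * of_real (x * cosh \<phi>) ^ (k - a) * of_real (sinh \<phi> ^ (2 * l + 1)))"
          by (simp only: of_real_mult of_real_power)
        then show "c k a / ?X * (poly (monom 1 a) (of_real (cos \<psi>)) * of_real (sin \<psi>) powr \<mu>) *
            complex_of_real (x ^ (2 * l + 1) * (exp (- x * (cosh \<phi> - 1)) * (x * cosh \<phi>) ^ (k - a) * sinh \<phi> ^ (2 * l + 1)))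
          = of_real (exp (- x * (cosh \<phi> - 1))) * of_real (sin \<psi>) powr \<mu> * of_real (sinh \<phi> ^ (2 * l + 1)) *
            (c k a * of_real (cos \<psi>) ^ a * of_real (x * cosh \<phi>) ^ (k - a))"
          using X by (simp only: poly_monom) (simp add: divide_simps)
      qed
    qed
    ultimately have "(?f has_integral (\<Sum>k\<le>j. \<Sum>a\<le>k. (c k a / ?X * (poly (monom 1 a) (of_real (cos \<psi>)) * of_real (sin \<psi>) powr \<mu>)) * of_real (hyp_moment x l (k - a)))) {0..}"
      by (simp only:)
    also have "(\<Sum>k\<le>j. \<Sum>a\<le>k. (c k a / ?X * (poly (monom 1 a) (of_real (cos \<psi>)) * of_real (sin \<psi>) powr \<mu>)) * of_real (hyp_moment x l (k - a))) = ?r"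
      by (intro sum.cong refl) simp
    finally show "(?f has_integral ?r) {0..}" .
  qed
  have "integral {0..pi} (\<lambda>\<psi>. \<Sum>k\<le>j. \<Sum>a\<le>k. c k a * of_real (hyp_moment x l (k - a)) / ?X * (poly (monom 1 a) (of_real (cos \<psi>)) * of_real (sin \<psi>) powr \<mu>))
     = (\<Sum>k\<le>j. \<Sum>a\<le>k. c k a * of_real (hyp_moment x l (k - a)) / ?X * sin_int \<mu> (monom 1 a))"
    by (intro integral_unique has_integral_sum has_integral_mult_right sin_int_has_integral \<mu>) auto
  then have "?X * integral {0..pi} (\<lambda>\<psi>. \<Sum>k\<le>j. \<Sum>a\<le>k. c k a * of_real (hyp_moment x l (k - a)) / ?X * (poly (monom 1 a) (of_real (cos \<psi>)) * of_real (sin \<psi>) powr \<mu>))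
     = (\<Sum>k\<le>j. \<Sum>a\<le>k. c k a * of_real (hyp_moment x l (k - a)) * sin_int \<mu> (monom 1 a))"
    using X by (simp add: sum_distrib_left)
  also have "\<dots> = (\<Sum>k\<le>j. (-1) ^ k * ((of_nat j + \<alpha>) gchoose (j - k)) * laguerre_moment \<mu> l k x)"
    unfolding laguerre_moment_def sum_distrib_left
  proof (intro sum.cong refl)
    fix k a :: nat assume "a \<in> {..k}"
    then have "complex_of_nat (k choose a) = fact k / (fact a * fact (k - a))" by (intro binomial_fact) simp
    then show "c k a * of_real (hyp_moment x l (k - a)) * sin_int \<mu> (monom 1 a)
       = (-1) ^ k * ((of_nat j + \<alpha>) gchoose (j - k)) * (sin_int \<mu> (monom 1 a) / fact a * of_real x ^ a * (of_real (hyp_moment x l (k - a)) / fact (k - a)))"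
      by (simp add: c_def)
  qed
  finally show ?thesis unfolding inner .
qed

section \<open>Polynomial dependence on x and the exact degree\<close>

definition hyp_moment_poly :: "nat \<Rightarrow> nat \<Rightarrow> complex poly" where
  "hyp_moment_poly l b = (\<Sum>k\<le>l. \<Sum>i\<le>b. monom (of_nat (l choose k) * 2 ^ (l - k) * of_nat (b choose i) * fact (l + k + i)) (l - k + (b - i)))"

lemma poly_hyp_moment_poly: "poly (hyp_moment_poly l b) (of_real x) = of_real (hyp_moment x l b)"
  unfolding hyp_moment_poly_def hyp_moment_def poly_sum poly_monom of_real_sum power_add power_mult_distrib
  by (intro sum.cong refl) simp

lemma coeff_hyp_moment_poly_eq_0:
  assumes "n > l + b"
  shows "coeff (hyp_moment_poly l b) n = 0"
  unfolding hyp_moment_poly_def coeff_sum using assms by (intro sum.neutral ballI) (auto simp: coeff_monom)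

text \<open>The exponent \<open>l - k + (b - i)\<close> reaches \<open>l + b\<close> only for
  \<open>k = i = 0\<close>.\<close>

lemma coeff_hyp_moment_poly_top: "coeff (hyp_moment_poly l b) (l + b) = 2 ^ l * fact l"
proof -
  have "coeff (hyp_moment_poly l b) (l + b) = (\<Sum>k\<le>l. \<Sum>i\<le>b. if k = 0 \<and> i = 0 then 2 ^ l * fact l else 0)"
    unfolding hyp_moment_poly_def coeff_sum by (intro sum.cong refl) (auto simp: coeff_monom)
  also have "\<dots> = (\<Sum>k\<le>l. if k = 0 then 2 ^ l * fact l else 0)"
    by (intro sum.cong refl) (auto simp: sum.delta)
  finally show ?thesis by (simp add: sum.delta)
qed

text \<open>The block with index \<open>k\<close> has degree at most \<open>k + l\<close>, so the
  coefficient at \<open>j + l\<close> comes from \<open>k = j\<close> alone. There the generalized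
  binomial is 1, and summing over \<open>a\<close> gives a nonzero multiple of the integral of (1 +
  cos \<psi>)^j sin(\<psi>)^\<mu>.\<close>

lemma laguerre_moment_sum_poly:
  assumes \<mu>: "Re \<mu> > -1"
  obtains p :: "complex poly" where "degree p = j + l"
    "\<And>x. poly p (of_real x) = (\<Sum>k\<le>j. (-1) ^ k * ((of_nat j + \<alpha>) gchoose (j - k)) * laguerre_moment \<mu> l k x)"
proof
  define d where "d k a = (-1) ^ k * ((of_nat j + \<alpha>) gchoose (j - k)) * (sin_int \<mu> (monom 1 a) / (fact a * fact (k - a)))" for k a
  let ?p = "\<Sum>k\<le>j. \<Sum>a\<le>k. monom (d k a) a * hyp_moment_poly l (k - a)"
  have c: "coeff (monom (d k a) a * hyp_moment_poly l (k - a)) n = (if n = j + l \<and> k = j then d j a * (2 ^ l * fact l) else 0)"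
    if "n \<ge> j + l" "k \<le> j" "a \<le> k" for n k a
  proof (cases "n = j + l \<and> k = j")
    case True
    then have n: "n - a = l + (k - a)" using that by auto
    have "coeff (monom (d k a) a * hyp_moment_poly l (k - a)) n = d k a * coeff (hyp_moment_poly l (k - a)) (n - a)"
      using that by (simp add: coeff_monom_mult)
    then show ?thesis unfolding n coeff_hyp_moment_poly_top using True by simp
  next
    case False
    then show ?thesis using that by (auto simp: coeff_monom_mult intro!: coeff_hyp_moment_poly_eq_0)
  qed
  have "(\<Sum>a\<le>j. d j a) = (-1) ^ j / fact j * (\<Sum>a\<le>j. of_nat (j choose a) * sin_int \<mu> (monom 1 a))"
    unfolding sum_distrib_left
  proof (intro sum.cong refl)
    fix a assume "a \<in> {..j}"
    then have "complex_of_nat (j choose a) = fact j / (fact a * fact (j - a))" by (intro binomial_fact) simp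
    then show "d j a = (-1) ^ j / fact j * (of_nat (j choose a) * sin_int \<mu> (monom 1 a))" by (simp add: d_def)
  qed
  also have "(\<Sum>a\<le>j. of_nat (j choose a) * sin_int \<mu> (monom 1 a)) = sin_int \<mu> ([:1, 1:] ^ j)"
  proof -
    have "[:1, 1:] ^ j = (\<Sum>a\<le>j. smult (of_nat (j choose a)) (monom (1 :: complex) a))"
      by (rule poly_ext) (simp add: poly_sum poly_monom binomial_ring[of _ 1, simplified] add.commute[of 1])
    then show ?thesis by (simp add: sin_int_sum sin_int_smult \<mu>)
  qed
  finally have nz: "(\<Sum>a\<le>j. d j a) \<noteq> 0" using sin_int_one_plus_cos_power_nonzero[OF \<mu>] by simp
  have "coeff ?p n = (\<Sum>k\<le>j. \<Sum>a\<le>k. if n = j + l \<and> k = j then d j a * (2 ^ l * fact l) else 0)" if "n \<ge> j + l" for n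
    unfolding coeff_sum by (intro sum.cong refl c that) auto
  moreover have "(\<Sum>k\<le>j. \<Sum>a\<le>k. if n = j + l \<and> k = j then d j a * (2 ^ l * fact l) else 0)
     = (\<Sum>k\<le>j. if k = j then (\<Sum>a\<le>j. if n = j + l then d j a * (2 ^ l * fact l) else 0) else 0)" for n
    by (intro sum.cong refl) auto
  ultimately have co: "coeff ?p n = (if n = j + l then (\<Sum>a\<le>j. d j a) * (2 ^ l * fact l) else 0)" if "n \<ge> j + l" for n
    using that by (simp add: sum.delta sum_distrib_right)
  show "degree ?p = j + l"
  proof (rule antisym)
    show "degree ?p \<le> j + l" by (rule degree_le) (use co in simp)
    show "j + l \<le> degree ?p" by (rule le_degree) (use co[of "j + l"] nz in simp)
  qed
  show "poly ?p (of_real x) = (\<Sum>k\<le>j. (-1) ^ k * ((of_nat j + \<alpha>) gchoose (j - k)) * laguerre_moment \<mu> l k x)" for x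
    unfolding poly_sum poly_mult poly_hyp_moment_poly poly_monom laguerre_moment_def sum_distrib_left
    by (intro sum.cong refl) (simp add: d_def)
qed

theorem theorem2p7:
  fixes \<mu> :: complex and l j :: nat
  assumes "Re \<mu> > -1"
  defines "F \<equiv> (\<lambda>x::real. of_real (x ^ (2 * l + 1)) *
      integral {0..pi} (\<lambda>\<psi>::real. integral {0..} (\<lambda>\<phi>::real.
        of_real (exp (- x * (cosh \<phi> - 1)))
        * laguerre j (of_nat l + (\<mu> + 1) / 2) (of_real (x * (cos \<psi> + cosh \<phi>)))
        * of_real (sin \<psi>) powr \<mu> * of_real (sinh \<phi> ^ (2 * l + 1)))))"
  shows "(\<exists>p :: complex poly. degree p = j + l \<and> (\<forall>x>0. F x = poly p (of_real x)))
       \<and> (\<forall>x>0. F x = 2 powr \<mu> * fact l * Gamma ((\<mu> + 1) / 2) * Gamma (of_nat j + (\<mu> + 1) / 2)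
                       / Gamma (of_nat j + \<mu> + 1) * M_fun \<mu> l j (2 * x))"
proof (intro conjI allI impI)
  note \<mu> = assms(1)
  let ?S = "\<lambda>x. \<Sum>k\<le>j. (-1) ^ k * ((of_nat j + (of_nat l + (\<mu> + 1) / 2)) gchoose (j - k)) * laguerre_moment \<mu> l k x"
  have F: "F x = ?S x" if "x > 0" for x
    unfolding F_def by (rule double_integral_eq[OF \<mu> that])
  obtain p :: "complex poly" where "degree p = j + l" "\<And>x. poly p (of_real x) = ?S x"
    using laguerre_moment_sum_poly[OF \<mu>] by blast
  then show "\<exists>p :: complex poly. degree p = j + l \<and> (\<forall>x>0. F x = poly p (of_real x))"
    using F by auto
  fix x :: real assume x: "x > 0"
  \<comment> \<open>Both arguments have positive real part, so the Gamma factors in the claimed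
    constant cancel those in \<open>M_fun\<close>.\<close>
  have nz: "Gamma (of_nat j + (\<mu> + 1) / 2) \<noteq> 0" "Gamma (of_nat j + \<mu> + 1) \<noteq> 0"
    using \<mu> Re_pos_not_nonpos_Int[of "of_nat j + (\<mu> + 1) / 2"] Re_pos_not_nonpos_Int[of "of_nat j + \<mu> + 1"]
    by (simp_all add: Gamma_eq_zero_iff add_nonneg_pos)
  have "F x = fact l * Gamma ((\<mu> + 1) / 2) * (deriv ^^ j) (\<lambda>t. G_fun \<mu> l t (2 * x)) 0 / fact j"
    unfolding F[OF x] deriv_G_fun[OF \<mu> x] by simp
  also have "\<dots> = 2 powr \<mu> * fact l * Gamma ((\<mu> + 1) / 2) * Gamma (of_nat j + (\<mu> + 1) / 2)
                       / Gamma (of_nat j + \<mu> + 1) * M_fun \<mu> l j (2 * x)"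
    unfolding M_fun_def using nz by simp
  finally show "F x = 2 powr \<mu> * fact l * Gamma ((\<mu> + 1) / 2) * Gamma (of_nat j + (\<mu> + 1) / 2)
                       / Gamma (of_nat j + \<mu> + 1) * M_fun \<mu> l j (2 * x)" .
qed

end
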